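(* Let $Y(t)$, $t\ge 0$, be a critical Markov branching process with non-homogeneous Poisson immigration, with offspring p.g.f. $f(s)=s+(1-s)^{\gamma+1}L(1/(1-s))$, $s\in[0,1)$, $\gamma\in(0,1]$, immigrant p.g.f. $g(s)=1-(1-s)^{\alpha}l(1/(1-s))$, $\alpha\in(0,1]$, and Poisson intensity $r(t)=t^{-\theta}L_R(t)$, where $L,l,L_R$ are slowly varying at infinity. Assume additionally that $0<\theta<1$ and $0<\alpha/\gamma<1$. (i) If $\theta+\alpha/\gamma>1$, or if $\theta+\alpha/\gamma=1$ and $L_R(t)L_Q(t)\to 0$ as $t\to\infty$, then $$\mathbf{P}\{Y(t)>0\}\sim t\,r(t)\,q(t)\,\mathbb{B}(1-\alpha/\gamma,\,1-\theta),\qquad t\to\infty,$$ where $\mathbb{B}(\cdot,\cdot)$ is Euler's beta function. (ii) If $\theta+\alpha/\gamma=1$ and $L_R(t)L_Q(t)\to K\in(0,\infty)$ as $t\to\infty$, then $$\mathbf{P}\{Y(t)>0\}\to 1-e^{-K\pi/\sin(\pi\theta)},\qquad t\to\infty .$$ (iii) If $\theta+\alpha/\gamma<1$, or if $\theta+\alpha/\gamma=1$ and $L_R(t)L_Q(t)\to\infty$ as $t\to\infty$, then $$\mathbf{P}\{Y(t)>0\}\to 1,\qquad t\to\infty .$$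
   Context: Model. In a Markov branching process each particle, independently of all others, lives an exponentially distributed time with parameter $\mu>0$ and at its death produces a random number $\xi\ge 0$ of new particles of the same type; $f(s)=\mathbf{E}[s^{\xi}]$ is the offspring p.g.f. Let $Z(t)$ be the number of particles at time $t$ and $F(t;s)=\mathbf{E}[s^{Z(t)}\mid Z(0)=1]$, so $\partial F(t;s)/\partial t=\mu[f(F(t;s))-F(t;s)]$, $F(0;s)=s$. Let $\nu(t)$ be a non-homogeneous Poisson process with intensity $r(t)$, mean measure $R(t)=\int_0^t r(u)\,du$ (finite for each $t$), and jump points $0=S_0<S_1<S_2<\cdots$. At each $S_k$, $k\ge1$, $I_k$ new particles immigrate, where $I_1,I_2,\dots$ are i.i.d. non-negative integer-valued with p.g.f. $g(s)=\mathbf{E}[s^{I_k}]$. The Markov branching process with non-homogeneous Poisson immigration is $$Y(t)=\sum_{k=1}^{\nu(t)}\sum_{j=1}^{I_k}Z^{(k,j)}(t-S_k),\qquad t\ge 0,$$ where $Z^{(k,j)}$ are i.i.d. copies of $Z$ started from one particle; the processes $Z^{(k,j)}$, the variables $I_k$ and the Poisson process $\nu$ are independent. Notation. $q(t;s)=1-g(F(t;s))$, $q(t)=q(t;0)$. The function $q(t)$ is regularly varying at infinity with exponent $-\alpha/\gamma$, and $L_Q$ denotes a slowly varying function at infinity with $q(t)\sim t^{-\alpha/\gamma}L_Q(t)$ as $t\to\infty$. The symbol $a(t)\sim b(t)$ means $a(t)/b(t)\to1$. *)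

theory Defs
  imports "HOL-Probability.Probability" "HOL-Library.Landau_Symbols"
begin

(* Positivity and measurability are only required on some half-line [A, \<infinity>). *)
definition slowly_varying :: "(real \<Rightarrow> real) \<Rightarrow> bool" where
  "slowly_varying L \<longleftrightarrow>
     (\<exists>A. (\<forall>x\<ge>A. 0 < L x) \<and> L \<in> borel_measurable (restrict_space borel {A..})) \<and>
     (\<forall>c>0. ((\<lambda>x. L (c * x) / L x) \<longlongrightarrow> 1) at_top)"

definition pgf :: "nat pmf \<Rightarrow> real \<Rightarrow> real" where
  "pgf p s = measure_pmf.expectation p (\<lambda>n. s ^ n)"

definition mean_one :: "nat pmf \<Rightarrow> bool" where
  "mean_one p \<longleftrightarrow> integrable (measure_pmf p) real \<and> measure_pmf.expectation p real = 1"

text \<open>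
  The family tree of a single ancestor. Particles are labelled by their line of descent: the
  ancestor is the empty list and \<open>u @ [i]\<close> is child number \<open>i\<close> (counted from 0) of \<open>u\<close>.
  \<open>T u \<omega>\<close> is the lifetime of particle \<open>u\<close> and \<open>X u \<omega>\<close> the number of children it leaves at death;
  both are given for all labels, whether or not the particle is ever born.
\<close>

definition in_tree :: "(nat list \<Rightarrow> 'a \<Rightarrow> nat) \<Rightarrow> 'a \<Rightarrow> nat list \<Rightarrow> bool" where
  "in_tree X \<omega> u \<longleftrightarrow> (\<forall>i<length u. u ! i < X (take i u) \<omega>)"

definition birth_time :: "(nat list \<Rightarrow> 'a \<Rightarrow> real) \<Rightarrow> 'a \<Rightarrow> nat list \<Rightarrow> real" where
  "birth_time T \<omega> u = (\<Sum>i<length u. T (take i u) \<omega>)"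

definition alive_at ::
  "(nat list \<Rightarrow> 'a \<Rightarrow> real) \<Rightarrow> (nat list \<Rightarrow> 'a \<Rightarrow> nat) \<Rightarrow> real \<Rightarrow> 'a \<Rightarrow> nat list set" where
  "alive_at T X t \<omega> =
     {u. in_tree X \<omega> u \<and> birth_time T \<omega> u \<le> t \<and> t < birth_time T \<omega> u + T u \<omega>}"

(* When the offspring mean is finite, alive_at is almost surely finite, so the convention that an
   infinite set has cardinality 0 only matters on a null set. *)
definition markov_branching_process ::
  "'a measure \<Rightarrow> real \<Rightarrow> nat pmf \<Rightarrow> (real \<Rightarrow> 'a \<Rightarrow> nat) \<Rightarrow> bool" where
  "markov_branching_process M \<mu> p Z \<longleftrightarrow>
     (\<exists>T X.
        (\<forall>u. distributed M lborel (T u) (exponential_density \<mu>)) \<and>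
        (\<forall>u. X u \<in> measurable M (count_space UNIV) \<and>
             distr M (count_space UNIV) (X u) = measure_pmf p) \<and>
        prob_space.indep_vars M (\<lambda>_. borel)
          (case_sum T (\<lambda>u \<omega>. real (X u \<omega>))) (UNIV :: (nat list + nat list) set) \<and>
        (\<forall>t\<ge>0. \<forall>\<omega>\<in>space M. Z t \<omega> = card (alive_at T X t \<omega>)))"

text \<open>Counting process of the jump points \<open>S 1, S 2, \<dots>\<close>; the value \<open>S 0 = 0\<close> is not a jump.\<close>

definition jump_count :: "(nat \<Rightarrow> 'a \<Rightarrow> real) \<Rightarrow> real \<Rightarrow> 'a \<Rightarrow> nat" where
  "jump_count S t \<omega> = card {k. 1 \<le> k \<and> S k \<omega> \<le> t}"

definition mean_measure :: "(real \<Rightarrow> real) \<Rightarrow> real \<Rightarrow> real" where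
  "mean_measure r t = (LINT u:{0..t}|lborel. r u)"

(* The counting process is finite and nondecreasing in t, so the subtractions on nat below do not
   truncate. *)
definition nonhom_poisson_process ::
  "'a measure \<Rightarrow> (real \<Rightarrow> real) \<Rightarrow> (nat \<Rightarrow> 'a \<Rightarrow> real) \<Rightarrow> bool" where
  "nonhom_poisson_process M r S \<longleftrightarrow>
     (\<forall>t>0. 0 \<le> r t) \<and> (\<forall>t\<ge>0. set_integrable lborel {0..t} r) \<and>
     (\<forall>k. S k \<in> borel_measurable M) \<and>
     (\<forall>\<omega>\<in>space M. S 0 \<omega> = 0 \<and> strict_mono (\<lambda>k. S k \<omega>) \<and> (\<forall>t. finite {k. S k \<omega> \<le> t})) \<and>
     (\<forall>\<tau> :: nat \<Rightarrow> real. 0 \<le> \<tau> 0 \<longrightarrow> mono \<tau> \<longrightarrow>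
        prob_space.indep_vars M (\<lambda>_. count_space UNIV)
          (\<lambda>i \<omega>. jump_count S (\<tau> (Suc i)) \<omega> - jump_count S (\<tau> i) \<omega>) UNIV) \<and>
     (\<forall>s t n. 0 \<le> s \<longrightarrow> s \<le> t \<longrightarrow>
        measure M {\<omega>\<in>space M. jump_count S t \<omega> - jump_count S s \<omega> = n} =
          exp (- (mean_measure r t - mean_measure r s)) *
          (mean_measure r t - mean_measure r s) ^ n / fact n)"

text \<open>
  The independent sources of randomness: the Poisson process, the sizes of the immigrant groups,
  and the processes started by the individual immigrants.
\<close>

datatype source = Jumps | Group_size nat | Descent nat nat

fun source_sigma ::
  "'a measure \<Rightarrow> (nat \<Rightarrow> 'a \<Rightarrow> real) \<Rightarrow> (nat \<Rightarrow> 'a \<Rightarrow> nat) \<Rightarrow>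
   (nat \<Rightarrow> nat \<Rightarrow> real \<Rightarrow> 'a \<Rightarrow> nat) \<Rightarrow> source \<Rightarrow> 'a set set" where
  "source_sigma M S I Z Jumps =
     sigma_sets (space M) {S k -` B \<inter> space M | k B. B \<in> sets borel}"
| "source_sigma M S I Z (Group_size k) =
     sigma_sets (space M) {I k -` B \<inter> space M | B. True}"
| "source_sigma M S I Z (Descent k j) =
     sigma_sets (space M) {Z k j t -` B \<inter> space M | t B. 0 \<le> t}"

definition branching_immigration_model ::
  "'a measure \<Rightarrow> real \<Rightarrow> nat pmf \<Rightarrow> nat pmf \<Rightarrow> (real \<Rightarrow> real) \<Rightarrow>
   (nat \<Rightarrow> 'a \<Rightarrow> real) \<Rightarrow> (nat \<Rightarrow> 'a \<Rightarrow> nat) \<Rightarrow> (nat \<Rightarrow> nat \<Rightarrow> real \<Rightarrow> 'a \<Rightarrow> nat) \<Rightarrow> bool" where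
  "branching_immigration_model M \<mu> p h r S I Z \<longleftrightarrow>
     prob_space M \<and> 0 < \<mu> \<and>
     nonhom_poisson_process M r S \<and>
     (\<forall>k\<ge>1. I k \<in> measurable M (count_space UNIV) \<and>
             distr M (count_space UNIV) (I k) = measure_pmf h) \<and>
     (\<forall>k\<ge>1. \<forall>j\<ge>1. markov_branching_process M \<mu> p (Z k j)) \<and>
     prob_space.indep_sets M (source_sigma M S I Z)
       ({Jumps} \<union> {Group_size k | k. 1 \<le> k} \<union> {Descent k j | k j. 1 \<le> k \<and> 1 \<le> j})"

definition Y_process ::
  "(nat \<Rightarrow> 'a \<Rightarrow> real) \<Rightarrow> (nat \<Rightarrow> 'a \<Rightarrow> nat) \<Rightarrow> (nat \<Rightarrow> nat \<Rightarrow> real \<Rightarrow> 'a \<Rightarrow> nat) \<Rightarrow>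
   real \<Rightarrow> 'a \<Rightarrow> nat" where
  "Y_process S I Z t \<omega> =
     (\<Sum>k=1..jump_count S t \<omega>. \<Sum>j=1..I k \<omega>. Z k j (t - S k \<omega>) \<omega>)"

definition branching_pgf :: "'a measure \<Rightarrow> (real \<Rightarrow> 'a \<Rightarrow> nat) \<Rightarrow> real \<Rightarrow> real \<Rightarrow> real" where
  "branching_pgf M Z t s = (LINT \<omega>|M. s ^ Z t \<omega>)"

definition q_fun :: "'a measure \<Rightarrow> nat pmf \<Rightarrow> (real \<Rightarrow> 'a \<Rightarrow> nat) \<Rightarrow> real \<Rightarrow> real \<Rightarrow> real" where
  "q_fun M h Z t s = 1 - pgf h (branching_pgf M Z t s)"

end

theory Submission
  imports Defs
begin

text \<open>
  Individuals present at time \<open>t\<close> descend from immigrant groups, and a group arriving at time \<open>u\<close>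
  still has living descendants at time \<open>t\<close> with probability \<open>q (t - u)\<close>. Keeping only the groups that
  survive thins the Poisson process of arrivals, so the number of surviving groups is Poisson with mean
  \<open>\<Lambda> t\<close>, the integral of \<open>r u * q (t - u)\<close> over \<open>0 < u \<le> t\<close>, and
  \<open>P (Y t > 0) = 1 - exp (- \<Lambda> t)\<close> (lemma \<open>prob_Y_pos\<close>). The three cases of the theorem are the cases
  \<open>\<Lambda> t \<rightarrow> 0\<close>, \<open>\<Lambda> t \<rightarrow> K * pi / sin (pi * \<theta>)\<close> and \<open>\<Lambda> t \<rightarrow> \<infinity>\<close>.

  The behaviour of \<open>\<Lambda>\<close> is a statement about the convolution of two regularly varying functions
  (\<open>convolution_asymp_equiv\<close>): after the substitution \<open>u = t * x\<close> the integrand divided by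
  \<open>r t * q t\<close> tends to \<open>x powr (- \<theta>) * (1 - x) powr (- \<alpha> / \<gamma>)\<close>, whose integral over the unit interval is
  the Beta function. Potter's bound (\<open>potter_lower\<close>) dominates the integrand away from both end points,
  and the two end pieces are negligible because \<open>t * r t\<close> and \<open>t * q t\<close> tend to infinity. Potter's bound
  rests on the local boundedness of slowly varying functions, which is where measurability enters. Then
  \<open>\<Lambda> t\<close> is asymptotic to \<open>t powr (1 - \<theta> - \<alpha> / \<gamma>) * L_R t * L_Q t\<close> times a Beta value, and the cases
  are read off from the exponent.

  The exponential formula needs care, since the age \<open>t - S k\<close> of a group is random while independence
  concerns the events \<open>Z k j s = 0\<close> at fixed times \<open>s\<close>. The arrival times are therefore rounded down to a grid.
  With rounded ages everything is a countable sum of products of independent events, and the formula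
  becomes a finite product of Poisson generating functions. The grid is then refined. Rounding down
  makes ages decrease to the true age, so right-continuity of the paths suffices. It holds almost surely because
  almost surely only finitely many particles are born before a given time
  (\<open>AE_finitely_many_births\<close>); this is where the offspring mean being one is used.
\<close>

section \<open>Slowly and regularly varying functions\<close>

lemma slowly_varyingE:
  assumes "slowly_varying L"
  obtains A where "1 \<le> A" "\<And>x. A \<le> x \<Longrightarrow> 0 < L x"
    "(\<lambda>x. indicator {A..} x * L x) \<in> borel_measurable borel"
proof -
  obtain A where A: "\<forall>x\<ge>A. 0 < L x" "L \<in> borel_measurable (restrict_space borel {A..})"
    using assms unfolding slowly_varying_def by blast
  have "(\<lambda>x. indicator {A..} x *\<^sub>R L x) \<in> borel_measurable borel"
    using A(2) by (subst (asm) borel_measurable_restrict_space_iff) auto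
  then have "(\<lambda>x. indicator {max A 1..} x * (indicator {A..} x *\<^sub>R L x)) \<in> borel_measurable borel"
    by measurable
  also have "(\<lambda>x. indicator {max A 1..} x * (indicator {A..} x *\<^sub>R L x)) = (\<lambda>x. indicator {max A 1..} x * L x)"
    by (auto simp: indicator_def)
  finally show ?thesis using A(1) by (intro that[of "max A 1"]) auto
qed

lemma slowly_varying_ratio:
  "slowly_varying L \<Longrightarrow> 0 < c \<Longrightarrow> ((\<lambda>x. L (c * x) / L x) \<longlongrightarrow> 1) at_top"
  by (simp add: slowly_varying_def)

lemma slowly_varying_inverse:
  assumes "slowly_varying L" shows "slowly_varying (\<lambda>x. inverse (L x))"
proof -
  obtain A where A: "\<forall>x\<ge>A. 0 < L x" "L \<in> borel_measurable (restrict_space borel {A..})"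
    using assms unfolding slowly_varying_def by blast
  have "((\<lambda>x. inverse (L (c * x)) / inverse (L x)) \<longlongrightarrow> 1) at_top" if "0 < c" for c
    using tendsto_inverse[OF slowly_varying_ratio[OF assms that]] by (simp add: divide_inverse mult.commute)
  with A show ?thesis unfolding slowly_varying_def
    by (intro conjI exI[of _ A] borel_measurable_inverse) auto
qed

lemma slowly_varying_mult:
  assumes "slowly_varying L" "slowly_varying L'" shows "slowly_varying (\<lambda>x. L x * L' x)"
proof -
  obtain A where A: "1 \<le> A" "\<And>x. A \<le> x \<Longrightarrow> 0 < L x" "(\<lambda>x. indicator {A..} x * L x) \<in> borel_measurable borel"
    using slowly_varyingE[OF assms(1)] by blast
  obtain B where B: "1 \<le> B" "\<And>x. B \<le> x \<Longrightarrow> 0 < L' x" "(\<lambda>x. indicator {B..} x * L' x) \<in> borel_measurable borel"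
    using slowly_varyingE[OF assms(2)] by blast
  note [measurable] = A(3) B(3)
  have "(\<lambda>x. (indicator {A..} x * L x) * (indicator {B..} x * L' x)) \<in> borel_measurable borel"
    by measurable
  also have "(\<lambda>x. (indicator {A..} x * L x) * (indicator {B..} x * L' x)) =
      (\<lambda>x. indicator {max A B..} x *\<^sub>R (L x * L' x))"
    by (auto simp: indicator_def)
  finally have "(\<lambda>x. L x * L' x) \<in> borel_measurable (restrict_space borel {max A B..})"
    by (subst borel_measurable_restrict_space_iff) auto
  moreover have "((\<lambda>x. (L (c * x) * L' (c * x)) / (L x * L' x)) \<longlongrightarrow> 1) at_top" if "0 < c" for c
    using tendsto_mult[OF slowly_varying_ratio[OF assms(1) that] slowly_varying_ratio[OF assms(2) that]] by simp
  ultimately show ?thesis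
    using A(2) B(2) unfolding slowly_varying_def by (intro conjI exI[of _ "max A B"]) auto
qed

lemma emeasure_lborel_translate:
  fixes B :: "real set"
  assumes [measurable]: "B \<in> sets borel"
  shows "emeasure lborel {z. z - x \<in> B} = emeasure lborel B"
proof -
  have "emeasure lborel B = emeasure (distr lborel borel ((+) (- x))) B"
    by (simp add: lborel_distr_plus)
  also have "\<dots> = emeasure lborel ((+) (- x) -` B \<inter> space lborel)"
    by (rule emeasure_distr) auto
  also have "(+) (- x) -` B \<inter> space lborel = {z. z - x \<in> B}"
    by (auto simp: algebra_simps)
  finally show ?thesis by simp
qed

text \<open>For large \<open>x\<close>, dominated convergence makes the set of \<open>v\<close> between 0 and 2 with \<open>\<bar>h (x + v) - h x\<bar> > 1\<close> smaller than
  one half, and likewise for \<open>x + u\<close> in place of \<open>x\<close>. The interval from \<open>x + 1\<close> to \<open>x + 2\<close> therefore contains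
  a point \<open>z\<close> at which \<open>h\<close> differs by at most 1 from both \<open>h x\<close> and \<open>h (x + u)\<close>.\<close>

lemma additive_local_boundedness:
  fixes h :: "real \<Rightarrow> real"
  assumes [measurable]: "h \<in> borel_measurable borel"
    and lim: "\<And>v. ((\<lambda>x. h (x + v) - h x) \<longlongrightarrow> 0) at_top"
  shows "\<exists>X. \<forall>x\<ge>X. \<forall>u\<in>{0..1}. \<bar>h (x + u) - h x\<bar> \<le> 2"
proof -
  define bad where "bad x = {v\<in>{0..2}. 1 < \<bar>h (x + v) - h x\<bar>}" for x
  have bad[measurable]: "bad x \<in> sets borel" for x unfolding bad_def by measurable
  have fin: "emeasure lborel (bad x) < \<infinity>" for x
  proof -
    have "emeasure lborel (bad x) \<le> emeasure lborel {0..2::real}"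
      by (rule emeasure_mono) (auto simp: bad_def)
    then show ?thesis by (simp add: order_le_less_trans)
  qed
  have "((\<lambda>x. LINT v|lborel. indicat_real (bad x) v) \<longlongrightarrow> (LINT (v::real)|lborel. 0)) at_top"
  proof (rule integral_dominated_convergence_at_top[where s="\<lambda>x. indicat_real (bad x)" and f="\<lambda>_. 0" and w="indicator {0..2}"])
    show "AE v in lborel. ((\<lambda>x. indicat_real (bad x) v) \<longlongrightarrow> 0) at_top"
    proof (intro AE_I2)
      fix v
      have "\<forall>\<^sub>F x in at_top. \<bar>h (x + v) - h x\<bar> < 1"
        using tendstoD[OF lim[of v], of 1] by (simp add: dist_real_def)
      then have "\<forall>\<^sub>F x in at_top. indicat_real (bad x) v = 0"
        by eventually_elim (auto simp: bad_def indicator_def)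
      then show "((\<lambda>x. indicat_real (bad x) v) \<longlongrightarrow> 0) at_top" by (rule tendsto_eventually)
    qed
  qed (auto simp: bad_def indicator_def intro!: always_eventually)
  then have "((\<lambda>x. measure lborel (bad x)) \<longlongrightarrow> 0) at_top"
    using fin by simp
  then have "\<forall>\<^sub>F x in at_top. measure lborel (bad x) < 1 / 2"
    by (rule order_tendstoD) simp
  then obtain X where X: "\<And>x. X \<le> x \<Longrightarrow> measure lborel (bad x) < 1 / 2"
    unfolding eventually_at_top_linorder by blast
  have "\<bar>h (x + u) - h x\<bar> \<le> 2" if "X \<le> x" "u \<in> {0..1}" for x u
  proof -
    \<comment> \<open>Two sets of measure below one half cannot cover an interval of length 1.\<close>
    have "\<exists>z. z - x \<notin> bad x \<and> z - (x + u) \<notin> bad (x + u) \<and> z \<in> {x+1..x+2}"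
    proof (rule ccontr)
      assume "\<not> ?thesis"
      then have sub: "{x+1..x+2} \<subseteq> {z. z - x \<in> bad x} \<union> {z. z - (x + u) \<in> bad (x + u)}" by blast
      have "ennreal 1 = emeasure lborel {x+1..x+2}" by simp
      also have "\<dots> \<le> emeasure lborel ({z. z - x \<in> bad x} \<union> {z. z - (x + u) \<in> bad (x + u)})"
        by (rule emeasure_mono[OF sub]) measurable
      also have "\<dots> \<le> emeasure lborel {z. z - x \<in> bad x} + emeasure lborel {z. z - (x + u) \<in> bad (x + u)}"
        by (rule emeasure_subadditive) measurable
      also have "\<dots> = ennreal (measure lborel (bad x)) + ennreal (measure lborel (bad (x + u)))"
        unfolding emeasure_lborel_translate[OF bad]
        using fin by (simp add: emeasure_eq_ennreal_measure less_top[symmetric])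
      also have "\<dots> = ennreal (measure lborel (bad x) + measure lborel (bad (x + u)))"
        by (simp add: ennreal_plus)
      finally have "1 \<le> measure lborel (bad x) + measure lborel (bad (x + u))"
        by (subst (asm) ennreal_le_iff) auto
      then show False using X[of x] X[of "x + u"] that by simp
    qed
    then obtain z where "z - x \<notin> bad x" "z - (x + u) \<notin> bad (x + u)" "z \<in> {x+1..x+2}" by blast
    then show ?thesis using that by (auto simp: bad_def)
  qed
  then show ?thesis by blast
qed

text \<open>The substitution \<open>h x = ln (L (exp x))\<close> turns slow variation into the additive hypothesis of the
  preceding lemma; the factor 2 in the argument is harmless because \<open>ln 2 \<le> 1\<close>.\<close>

lemma slowly_varying_local_boundedness:
  assumes L: "slowly_varying L"
  shows "\<exists>A\<ge>1. \<forall>x\<ge>A. 0 < L x \<and> (\<forall>y\<in>{x..2*x}. L x \<le> exp 2 * L y)"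
proof -
  obtain A where A: "1 \<le> A" "\<And>x. A \<le> x \<Longrightarrow> 0 < L x"
    and [measurable]: "(\<lambda>x. indicator {A..} x * L x) \<in> borel_measurable borel"
    using slowly_varyingE[OF L] by blast
  define h where "h x = ln (indicator {A..} (exp x) * L (exp x))" for x
  have [measurable]: "h \<in> borel_measurable borel"
    unfolding h_def by measurable
  have exp_ge: "A \<le> exp x" if "ln A \<le> x" for x
  proof -
    have "exp (ln A) \<le> exp x" using that by simp
    then show ?thesis using A(1) by simp
  qed
  have h: "h x = ln (L (exp x))" if "ln A \<le> x" for x
    using exp_ge[OF that] by (simp add: h_def indicator_def)
  have "((\<lambda>x. h (x + v) - h x) \<longlongrightarrow> 0) at_top" for v
  proof -
    have "((\<lambda>x. ln (L (exp v * x) / L x)) \<longlongrightarrow> ln 1) at_top"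
      by (intro tendsto_ln slowly_varying_ratio[OF L]) auto
    then have "((\<lambda>x. ln (L (exp v * exp x) / L (exp x))) \<longlongrightarrow> 0) at_top"
      using filterlim_compose[OF _ exp_at_top] by fastforce
    moreover have "\<forall>\<^sub>F x in at_top. ln (L (exp v * exp x) / L (exp x)) = h (x + v) - h x"
      using eventually_ge_at_top[of "ln A"] eventually_ge_at_top[of "ln A - v"]
    proof eventually_elim
      case (elim x)
      then have "A \<le> exp x" "A \<le> exp (x + v)" by (auto intro!: exp_ge)
      with elim show ?case
        using A(2)[of "exp x"] A(2)[of "exp (x + v)"] by (simp add: h ln_div exp_add mult.commute)
    qed
    ultimately show ?thesis by (rule Lim_transform_eventually)
  qed
  then have "\<exists>X. \<forall>x\<ge>X. \<forall>u\<in>{0..1}. \<bar>h (x + u) - h x\<bar> \<le> 2"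
    by (rule additive_local_boundedness[OF \<open>h \<in> borel_measurable borel\<close>])
  then obtain X where X: "\<And>x u. X \<le> x \<Longrightarrow> u \<in> {0..1} \<Longrightarrow> \<bar>h (x + u) - h x\<bar> \<le> 2"
    by blast
  have "0 < L x \<and> (\<forall>y\<in>{x..2*x}. L x \<le> exp 2 * L y)" if x: "max A (exp X) \<le> x" for x
  proof (intro conjI ballI)
    have x0: "0 < x" using x A(1) by simp
    show "0 < L x" using x A(2) by simp
    fix y assume y: "y \<in> {x..2*x}"
    have Ly: "0 < L y" using A(2)[of y] x y by simp
    have "ln y \<le> ln (2 * x)" using y x0 by simp
    also have "\<dots> \<le> 1 + ln x" using x0 ln_le_minus_one[of 2] by (simp add: ln_mult)
    finally have "ln y - ln x \<in> {0..1}" using y x0 by simp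
    moreover have "X \<le> ln x" using x x0 by (simp add: ln_ge_iff)
    ultimately have "\<bar>h (ln y) - h (ln x)\<bar> \<le> 2" using X[of "ln x" "ln y - ln x"] by simp
    moreover have "h (ln x) = ln (L x)" "h (ln y) = ln (L y)"
      using x y x0 A(1) by (simp_all add: h)
    ultimately have "ln (L x) \<le> 2 + ln (L y)" by simp
    also have "\<dots> = ln (exp 2 * L y)" using Ly by (simp add: ln_mult)
    finally show "L x \<le> exp 2 * L y" using Ly \<open>0 < L x\<close> by simp
  qed
  then show ?thesis using A(1) by (intro exI[of _ "max A (exp X)"]) auto
qed

text \<open>One half of Potter's bound; its other half is this lemma for the reciprocal of \<open>L\<close>. Doubling the argument
  costs at most a factor \<open>2 powr \<delta>\<close> once it is large, so \<open>log 2 (x / y)\<close> doublings cost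
  \<open>(x / y) powr \<delta>\<close>; local boundedness covers the last incomplete doubling.\<close>

lemma potter_lower:
  assumes L: "slowly_varying L" and \<delta>: "0 < \<delta>"
  shows "\<exists>A\<ge>1. \<forall>y x. A \<le> y \<longrightarrow> y \<le> x \<longrightarrow> 0 < L x \<and> L y \<le> exp 2 * (x / y) powr \<delta> * L x"
proof -
  obtain A where A: "1 \<le> A" "\<And>x. A \<le> x \<Longrightarrow> 0 < L x"
      "\<And>x y. A \<le> x \<Longrightarrow> y \<in> {x..2*x} \<Longrightarrow> L x \<le> exp 2 * L y"
    using slowly_varying_local_boundedness[OF L] by blast
  have "\<forall>\<^sub>F x in at_top. 2 powr (-\<delta>) < L (2 * x) / L x"
    using slowly_varying_ratio[OF L, of 2] powr_less_mono[of "-\<delta>" 0 2] \<delta>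
    by (intro order_tendstoD(1)) simp_all
  then obtain B where B: "\<And>x. B \<le> x \<Longrightarrow> 2 powr (-\<delta>) < L (2 * x) / L x"
    unfolding eventually_at_top_linorder by blast
  define A' where "A' = max A B"
  have double: "L y \<le> 2 powr \<delta> * L (2 * y)" if "A' \<le> y" for y
  proof -
    have "0 < L y" using A(2) that by (simp add: A'_def)
    with B[of y] that have "2 powr (-\<delta>) * L y \<le> L (2 * y)"
      by (simp add: A'_def pos_less_divide_eq)
    then show ?thesis by (simp add: powr_minus field_simps)
  qed
  have step: "L y \<le> exp 2 * (x / y) powr \<delta> * L x" if "A' \<le> y" "y \<le> x" "x \<le> 2 ^ n * y" for x y n
    using that
  proof (induction n arbitrary: y)
    case 0
    then have "x = y" "0 < y" "0 < L y" using A by (auto simp: A'_def)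
    then show ?case by simp
  next
    case (Suc n)
    have y: "0 < y" and x: "0 < L x" using Suc.prems A by (auto simp: A'_def)
    show ?case
    proof (cases "x \<le> 2 * y")
      case True
      then have "L y \<le> exp 2 * L x" using A(3)[of y x] Suc.prems by (simp add: A'_def)
      also have "\<dots> \<le> exp 2 * ((x / y) powr \<delta> * L x)"
        using ge_one_powr_ge_zero[of "x / y" \<delta>] Suc.prems \<delta> x y by (intro mult_left_mono) auto
      finally show ?thesis by (simp add: mult_ac)
    next
      case False
      have "L y \<le> 2 powr \<delta> * L (2 * y)" using Suc.prems by (intro double)
      also have "\<dots> \<le> 2 powr \<delta> * (exp 2 * (x / (2 * y)) powr \<delta> * L x)"
        using Suc.prems False y by (intro mult_left_mono Suc.IH) auto
      also have "\<dots> = exp 2 * (2 powr \<delta> * (x / (2 * y)) powr \<delta>) * L x" by (simp add: mult_ac)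
      also have "2 powr \<delta> * (x / (2 * y)) powr \<delta> = (x / y) powr \<delta>"
        using y False by (subst powr_mult[symmetric]) auto
      finally show ?thesis .
    qed
  qed
  have "0 < L x \<and> L y \<le> exp 2 * (x / y) powr \<delta> * L x" if "A' \<le> y" "y \<le> x" for x y
  proof -
    have y: "0 < y" using A that by (auto simp: A'_def)
    obtain n where "x / y < 2 ^ n" using real_arch_pow[of 2 "x / y"] by auto
    then have "x \<le> 2 ^ n * y" using y by (simp add: pos_divide_less_eq)
    with step that A(2)[of x] show ?thesis by (auto simp: A'_def)
  qed
  then show ?thesis using A(1) by (intro exI[of _ A']) (auto simp: A'_def)
qed

lemma powr_at_top:
  fixes p :: real assumes "0 < p" shows "filterlim (\<lambda>x. x powr p) at_top at_top"
proof -
  have lim: "filterlim (\<lambda>x. exp (p * ln x)) at_top at_top"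
    using assms by (intro filterlim_compose[OF exp_at_top]
      filterlim_tendsto_pos_mult_at_top[OF tendsto_const _ ln_at_top])
  have "\<forall>\<^sub>F x in at_top. exp (p * ln x) = x powr p"
    using eventually_gt_at_top[of 0] by eventually_elim (simp add: powr_def)
  from filterlim_cong[OF refl refl this, THEN iffD1, OF lim] show ?thesis .
qed

lemma slowly_varying_powr_at_top:
  assumes L: "slowly_varying L" and e: "0 < e"
  shows "filterlim (\<lambda>x. x powr e * L x) at_top at_top"
proof -
  obtain A where A: "1 \<le> A" "\<And>x y. A \<le> y \<Longrightarrow> y \<le> x \<Longrightarrow> 0 < L x \<and> L y \<le> exp 2 * (x / y) powr (e/2) * L x"
    using potter_lower[OF L, of "e/2"] e by auto
  define c where "c = L A / (exp 2 / A powr (e/2))"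
  have c: "0 < c" using A(1) A(2)[of A A] by (simp add: c_def)
  have "filterlim (\<lambda>x. c * x powr (e/2)) at_top at_top"
    using c e by (intro filterlim_tendsto_pos_mult_at_top[OF tendsto_const] powr_at_top) auto
  moreover have "\<forall>\<^sub>F x in at_top. c * x powr (e/2) \<le> x powr e * L x"
    using eventually_ge_at_top[of A]
  proof eventually_elim
    case (elim x)
    have x: "0 < x" using elim A(1) by simp
    have "L A \<le> exp 2 * (x powr (e/2) / A powr (e/2)) * L x"
      using A(2)[OF order_refl elim] A(1) x by (simp add: powr_divide)
    then have "c \<le> x powr (e/2) * L x"
      using A(1) by (simp add: c_def field_simps)
    then have "c * x powr (e/2) \<le> x powr (e/2) * L x * x powr (e/2)"
      by (rule mult_right_mono) simp
    also have "\<dots> = (x powr (e/2) * x powr (e/2)) * L x" by (simp add: mult_ac)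
    also have "x powr (e/2) * x powr (e/2) = x powr e" using x by (simp add: powr_add[symmetric])
    finally show ?case .
  qed
  ultimately show ?thesis by (rule filterlim_at_top_mono)
qed

lemma slowly_varying_powr_0:
  assumes L: "slowly_varying L" and e: "0 < e"
  shows "((\<lambda>x. x powr (- e) * L x) \<longlongrightarrow> 0) at_top"
proof -
  have "((\<lambda>x. inverse (x powr e * inverse (L x))) \<longlongrightarrow> 0) at_top"
    using slowly_varying_powr_at_top[OF slowly_varying_inverse[OF L] e]
    by (rule tendsto_inverse_0_at_top)
  then show ?thesis by (simp add: powr_minus)
qed

definition regularly_varying :: "(real \<Rightarrow> real) \<Rightarrow> real \<Rightarrow> bool" where
  "regularly_varying f \<rho> \<longleftrightarrow> (\<exists>L. slowly_varying L \<and> f \<sim>[at_top] (\<lambda>t. t powr \<rho> * L t))"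

lemma regularly_varyingE:
  assumes "regularly_varying f \<rho>"
  obtains L where "slowly_varying L" "((\<lambda>t. f t / (t powr \<rho> * L t)) \<longlongrightarrow> 1) at_top"
    "\<forall>\<^sub>F t in at_top. 0 < t powr \<rho> * L t"
proof -
  obtain L where L: "slowly_varying L" and equiv: "f \<sim>[at_top] (\<lambda>t. t powr \<rho> * L t)"
    using assms unfolding regularly_varying_def by blast
  obtain A where A: "1 \<le> A" "\<And>x. A \<le> x \<Longrightarrow> 0 < L x"
    using slowly_varyingE[OF L] by blast
  have pos: "\<forall>\<^sub>F t in at_top. 0 < t powr \<rho> * L t"
    using eventually_ge_at_top[of A] by eventually_elim (use A in force)
  have "((\<lambda>t. f t / (t powr \<rho> * L t)) \<longlongrightarrow> 1) at_top"
    using pos by (intro asymp_equivD_strong[OF equiv]) (auto elim!: eventually_mono)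
  from that[OF L this pos] show ?thesis .
qed

lemma regularly_varying_bounds:
  assumes "regularly_varying f \<rho>"
  obtains L where "slowly_varying L"
    "\<forall>\<^sub>F t in at_top. 0 < L t \<and> t powr \<rho> * L t / 2 \<le> f t \<and> f t \<le> 2 * (t powr \<rho> * L t)"
proof -
  obtain L where L: "slowly_varying L" and lim: "((\<lambda>t. f t / (t powr \<rho> * L t)) \<longlongrightarrow> 1) at_top"
    and pos: "\<forall>\<^sub>F t in at_top. 0 < t powr \<rho> * L t"
    using regularly_varyingE[OF assms] by blast
  have "\<forall>\<^sub>F t in at_top. 1/2 < f t / (t powr \<rho> * L t)" "\<forall>\<^sub>F t in at_top. f t / (t powr \<rho> * L t) < 2"
    using order_tendstoD(1)[OF lim, of "1/2"] order_tendstoD(2)[OF lim, of 2] by simp_all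
  with pos have "\<forall>\<^sub>F t in at_top. 0 < L t \<and> t powr \<rho> * L t / 2 \<le> f t \<and> f t \<le> 2 * (t powr \<rho> * L t)"
  proof eventually_elim
    case (elim t)
    then have "0 < L t" by (auto simp: zero_less_mult_iff)
    with elim show ?case by (auto simp: pos_less_divide_eq pos_divide_less_eq)
  qed
  with L show ?thesis by (rule that)
qed

lemma regularly_varying_potter:
  assumes f: "regularly_varying f \<rho>" and \<delta>: "0 < \<delta>"
  shows "\<exists>A\<ge>1. \<forall>y x. A \<le> y \<longrightarrow> y \<le> x \<longrightarrow> 0 < f x \<and> f y \<le> 4 * exp 2 * (x / y) powr (\<delta> - \<rho>) * f x"
proof -
  obtain L where L: "slowly_varying L" and
    ev: "\<forall>\<^sub>F t in at_top. 0 < L t \<and> t powr \<rho> * L t / 2 \<le> f t \<and> f t \<le> 2 * (t powr \<rho> * L t)"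
    using regularly_varying_bounds[OF f] by blast
  obtain A where A: "1 \<le> A" "\<And>x y. A \<le> y \<Longrightarrow> y \<le> x \<Longrightarrow> 0 < L x \<and> L y \<le> exp 2 * (x / y) powr \<delta> * L x"
    using potter_lower[OF L \<delta>] by blast
  obtain B where B: "\<And>t. B \<le> t \<Longrightarrow> t powr \<rho> * L t / 2 \<le> f t \<and> f t \<le> 2 * (t powr \<rho> * L t)"
    using ev unfolding eventually_at_top_linorder by blast
  have "0 < f x \<and> f y \<le> 4 * exp 2 * (x / y) powr (\<delta> - \<rho>) * f x" if "max A B \<le> y" "y \<le> x" for x y
  proof
    have y: "0 < y" and x: "0 < x" using that A(1) by auto
    have "0 < L x" using A(2)[of x x] that by simp
    then have "0 < x powr \<rho> * L x / 2" using x by simp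
    also have "\<dots> \<le> f x" using B[of x] that by simp
    finally show "0 < f x" .
    have "f y \<le> 2 * (y powr \<rho> * L y)" using B[of y] that by simp
    also have "\<dots> \<le> 2 * (y powr \<rho> * (exp 2 * (x / y) powr \<delta> * L x))"
      using A(2)[of y x] that by (intro mult_left_mono) auto
    also have "\<dots> = 4 * exp 2 * (x / y) powr (\<delta> - \<rho>) * (x powr \<rho> * L x / 2)"
      using x y by (simp add: powr_diff powr_divide field_simps)
    also have "\<dots> \<le> 4 * exp 2 * (x / y) powr (\<delta> - \<rho>) * f x"
      using B[of x] that by (intro mult_left_mono) auto
    finally show "f y \<le> 4 * exp 2 * (x / y) powr (\<delta> - \<rho>) * f x" .
  qed
  then show ?thesis using A(1) by (intro exI[of _ "max A B"]) auto
qed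

lemma regularly_varying_ratio:
  assumes f: "regularly_varying f \<rho>" and c: "0 < c"
  shows "((\<lambda>t. f (c * t) / f t) \<longlongrightarrow> c powr \<rho>) at_top"
proof -
  obtain L where L: "slowly_varying L" and lim: "((\<lambda>t. f t / (t powr \<rho> * L t)) \<longlongrightarrow> 1) at_top"
    and pos: "\<forall>\<^sub>F t in at_top. 0 < t powr \<rho> * L t"
    using regularly_varyingE[OF f] by blast
  have scale: "filterlim (\<lambda>t. c * t) at_top at_top"
    using c by (intro filterlim_tendsto_pos_mult_at_top[OF tendsto_const] filterlim_ident)
  have "((\<lambda>t. (f (c * t) / ((c * t) powr \<rho> * L (c * t))) * (c powr \<rho> * (L (c * t) / L t)) /
      (f t / (t powr \<rho> * L t))) \<longlongrightarrow> 1 * (c powr \<rho> * 1) / 1) at_top"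
    using lim filterlim_compose[OF lim scale] slowly_varying_ratio[OF L c]
    by (intro tendsto_intros) auto
  moreover have "\<forall>\<^sub>F t in at_top. (f (c * t) / ((c * t) powr \<rho> * L (c * t))) * (c powr \<rho> * (L (c * t) / L t)) /
      (f t / (t powr \<rho> * L t)) = f (c * t) / f t"
    using pos eventually_compose_filterlim[OF pos scale] eventually_gt_at_top[of 0]
  proof eventually_elim
    case (elim t)
    then have "L t \<noteq> 0" "L (c * t) \<noteq> 0" "t powr \<rho> \<noteq> 0" "c powr \<rho> \<noteq> 0" using c by auto
    with elim c show ?case by (simp add: powr_mult field_simps)
  qed
  ultimately show ?thesis by (simp add: Lim_transform_eventually)
qed

text \<open>This is what makes the end pieces of the convolution negligible.\<close>

lemma regularly_varying_times_id_at_top: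
  assumes f: "regularly_varying f \<rho>" and \<rho>: "-1 < \<rho>"
  shows "filterlim (\<lambda>t. t * f t) at_top at_top"
proof -
  obtain L where L: "slowly_varying L" and
    ev: "\<forall>\<^sub>F t in at_top. 0 < L t \<and> t powr \<rho> * L t / 2 \<le> f t \<and> f t \<le> 2 * (t powr \<rho> * L t)"
    using regularly_varying_bounds[OF f] by blast
  have "filterlim (\<lambda>t. (1/2) * (t powr (1 + \<rho>) * L t)) at_top at_top"
    using \<rho> by (intro filterlim_tendsto_pos_mult_at_top[OF tendsto_const] slowly_varying_powr_at_top[OF L]) auto
  moreover have "\<forall>\<^sub>F t in at_top. (1/2) * (t powr (1 + \<rho>) * L t) \<le> t * f t"
    using ev eventually_gt_at_top[of 0]
  proof eventually_elim
    case (elim t)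
    then have "t * (t powr \<rho> * L t / 2) \<le> t * f t" by (intro mult_left_mono) auto
    then show ?case using elim by (simp add: powr_add mult_ac)
  qed
  ultimately show ?thesis by (rule filterlim_at_top_mono)
qed

section \<open>Convolutions of regularly varying functions\<close>

text \<open>Near \<open>u = 0\<close> the argument \<open>t - u\<close> stays comparable to \<open>t\<close>, so \<open>g (t - u)\<close> is at most a constant times
  \<open>g t\<close>, whereas \<open>f\<close> contributes only its integral over a fixed interval. The other end of the
  convolution is the same with \<open>f\<close> and \<open>g\<close> exchanged.\<close>

lemma convolution_edge:
  fixes f g :: "real \<Rightarrow> real"
  assumes f: "\<And>u. 0 \<le> f u" "\<And>u. u \<le> 0 \<Longrightarrow> f u = 0"
    and f_int: "integrable lborel (\<lambda>u. indicator {..<A} u * f u)"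
    and [measurable]: "f \<in> borel_measurable borel" "g \<in> borel_measurable borel"
    and g: "\<And>u. 0 \<le> g u"
    and potter: "\<And>y x. A \<le> y \<Longrightarrow> y \<le> x \<Longrightarrow> g y \<le> C * (x / y) powr \<kappa> * g x"
    and "1 \<le> A" "0 \<le> \<kappa>" "0 \<le> C" "2 * A \<le> t"
  shows "integrable lborel (\<lambda>u. indicator {..<A} u * (f u * g (t - u)))" (is ?int)
    and "(LINT u|lborel. indicator {..<A} u * (f u * g (t - u))) \<le>
      C * 2 powr \<kappa> * g t * (LINT u|lborel. indicator {..<A} u * f u)" (is ?le)
proof -
  have bound: "indicator {..<A} u * (f u * g (t - u)) \<le> C * 2 powr \<kappa> * g t * (indicator {..<A} u * f u)" for u
  proof (cases "0 < u \<and> u < A")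
    case True
    have "g (t - u) \<le> C * (t / (t - u)) powr \<kappa> * g t"
      using True assms by (intro potter) auto
    also have "\<dots> \<le> C * 2 powr \<kappa> * g t"
      using True assms g by (intro mult_right_mono mult_left_mono powr_mono2) (auto simp: field_simps)
    finally have "f u * g (t - u) \<le> f u * (C * 2 powr \<kappa> * g t)"
      using f by (intro mult_left_mono) auto
    with True show ?thesis by (simp add: mult_ac)
  qed (use f in \<open>auto simp: indicator_def\<close>)
  have int: "integrable lborel (\<lambda>u. C * 2 powr \<kappa> * g t * (indicator {..<A} u * f u))"
    using f_int by simp
  show ?int
    by (rule Bochner_Integration.integrable_bound[OF int])
       (use bound f g assms in \<open>auto intro!: AE_I2 simp: abs_mult\<close>)
  then have "(LINT u|lborel. indicator {..<A} u * (f u * g (t - u))) \<le>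
      (LINT u|lborel. C * 2 powr \<kappa> * g t * (indicator {..<A} u * f u))"
    using int bound by (intro Bochner_Integration.integral_mono)
  then show ?le by simp
qed

text \<open>After \<open>u = t * x\<close> the integrand, divided by \<open>f t * g t\<close>, converges pointwise to that of a Beta integral, and the Potter bounds
  apply to both factors precisely because \<open>u\<close> and \<open>t - u\<close> are at least \<open>A\<close>. They dominate it by the
  integrand of a Beta integral with the slightly worse exponents \<open>\<rho>\<close> and \<open>\<sigma>\<close>, still integrable as these are below 1.\<close>

lemma convolution_middle:
  fixes f g :: "real \<Rightarrow> real"
  assumes f: "\<And>u. 0 \<le> f u" and g: "\<And>u. 0 \<le> g u"
    and [measurable]: "f \<in> borel_measurable borel" "g \<in> borel_measurable borel"
    and rv: "regularly_varying f (-a)" "regularly_varying g (-b)"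
    and potter_f: "\<And>y x. A \<le> y \<Longrightarrow> y \<le> x \<Longrightarrow> 0 < f x \<and> f y \<le> C * (x / y) powr \<rho> * f x"
    and potter_g: "\<And>y x. A \<le> y \<Longrightarrow> y \<le> x \<Longrightarrow> 0 < g x \<and> g y \<le> C * (x / y) powr \<sigma> * g x"
    and A: "1 \<le> A" and C: "0 \<le> C" and exps: "\<rho> < 1" "\<sigma> < 1" "a < 1" "b < 1"
  shows "((\<lambda>t. (LINT u|lborel. indicator {A..t-A} u * (f u * g (t - u))) / (t * f t * g t))
      \<longlongrightarrow> Beta (1 - b) (1 - a)) at_top"
    and "\<forall>\<^sub>F t in at_top. integrable lborel (\<lambda>u. indicator {A..t-A} u * (f u * g (t - u)))"
proof -
  define s where "s t x = indicator {A..t-A} (t * x) * ((f (t * x) / f t) * (g (t - t * x) / g t))" for t x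
  define w where "w x = C * C * (indicator {0..1} x * (x powr (- \<rho>) * (1 - x) powr (- \<sigma>)))" for x :: real
  have s_meas: "s t \<in> borel_measurable lborel" for t
    unfolding s_def by measurable
  have w_int: "integrable lborel w"
  proof -
    have "integrable lborel (\<lambda>x. indicator {0..1} x *\<^sub>R (x powr ((1 - \<rho>) - 1) * (1 - x) powr ((1 - \<sigma>) - 1)))"
      using integrable_Beta[of "1 - \<rho>" "1 - \<sigma>"] exps by (simp add: set_integrable_def)
    then show ?thesis unfolding w_def by simp
  qed
  have s_bound: "norm (s t x) \<le> w x" if t: "2 * A \<le> t" for t x
  proof (cases "t * x \<in> {A..t-A}")
    case True
    have t0: "0 < t" "A \<le> t" using t A by auto
    have "0 < t * x" "t * x < t" using True A unfolding atLeastAtMost_iff by linarith+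
    then have x: "0 < x" "x < 1"
      using t0 zero_less_mult_pos[of t x] mult_less_cancel_left_pos[of t x 1] by simp_all
    have le: "A \<le> t * x" "t * x \<le> t" "A \<le> t - t * x" "t - t * x \<le> t"
      using True A unfolding atLeastAtMost_iff by linarith+
    have pf: "0 < f t" "f (t * x) \<le> C * (t / (t * x)) powr \<rho> * f t"
      using potter_f[OF le(1,2)] by blast+
    have pg: "0 < g t" "g (t - t * x) \<le> C * (t / (t - t * x)) powr \<sigma> * g t"
      using potter_g[OF le(3,4)] by blast+
    have "f (t * x) / f t \<le> C * x powr (- \<rho>)"
    proof -
      have "t / (t * x) = inverse x" using t0 x by (simp add: divide_inverse)
      then have "(t / (t * x)) powr \<rho> = x powr (- \<rho>)" using x by (simp only: powr_minus inverse_powr)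
      with pf show ?thesis by (simp only: pos_divide_le_eq mult_ac)
    qed
    moreover have "g (t - t * x) / g t \<le> C * (1 - x) powr (- \<sigma>)"
    proof -
      have "t / (t - t * x) = inverse (1 - x)" using t0 x by (simp add: field_simps)
      then have "(t / (t - t * x)) powr \<sigma> = (1 - x) powr (- \<sigma>)" by (simp only: powr_minus inverse_powr)
      with pg show ?thesis by (simp only: pos_divide_le_eq mult_ac)
    qed
    ultimately have "(f (t * x) / f t) * (g (t - t * x) / g t) \<le> (C * x powr (- \<rho>)) * (C * (1 - x) powr (- \<sigma>))"
      using f g C by (intro mult_mono) auto
    then show ?thesis
      using True x f g by (simp add: s_def w_def abs_mult mult_ac)
  qed (use C in \<open>simp add: s_def w_def\<close>)
  have s_lim: "((\<lambda>t. s t x) \<longlongrightarrow> indicator {0<..<1} x * (x powr (- a) * (1 - x) powr (- b))) at_top" for x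
  proof (cases "x \<in> {0<..<1}")
    case True
    then have x: "0 < x" "0 < 1 - x" by auto
    have "((\<lambda>t. (f (x * t) / f t) * (g ((1 - x) * t) / g t)) \<longlongrightarrow> x powr (- a) * (1 - x) powr (- b)) at_top"
      using regularly_varying_ratio[OF rv(1) x(1)] regularly_varying_ratio[OF rv(2) x(2)]
      by (rule tendsto_mult)
    moreover have "\<forall>\<^sub>F t in at_top. (f (x * t) / f t) * (g ((1 - x) * t) / g t) = s t x"
      using eventually_ge_at_top[of "A / x"] eventually_ge_at_top[of "A / (1 - x)"]
    proof eventually_elim
      case (elim t)
      then have "A \<le> t * x" "t * x \<le> t - A" using x by (auto simp: pos_divide_le_eq algebra_simps)
      then show ?case by (simp add: s_def algebra_simps)
    qed
    ultimately show ?thesis using True by (simp add: Lim_transform_eventually)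
  next
    case False
    have "\<forall>\<^sub>F t in at_top. 0 = s t x"
      using eventually_gt_at_top[of 0]
    proof eventually_elim
      case (elim t)
      have "t * x \<notin> {A..t-A}"
      proof
        assume "t * x \<in> {A..t-A}"
        then have "0 < t * x" "t * x < t" using A unfolding atLeastAtMost_iff by linarith+
        then show False
          using False elim zero_less_mult_pos[of t x] mult_less_cancel_left_pos[of t x 1] by simp
      qed
      then show ?case by (simp add: s_def)
    qed
    then show ?thesis using False by (simp add: Lim_transform_eventually[OF tendsto_const])
  qed
  have s_bound': "\<forall>\<^sub>F t in at_top. AE x in lborel. norm (s t x) \<le> w x"
    using eventually_ge_at_top[of "2 * A"] by eventually_elim (intro AE_I2 s_bound)
  have "((\<lambda>t. LINT x|lborel. s t x) \<longlongrightarrow> (LINT x|lborel. indicator {0<..<1} x * (x powr (- a) * (1 - x) powr (- b)))) at_top"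
    by (rule integral_dominated_convergence_at_top[OF _ s_meas w_int AE_I2 s_bound']) (measurable, rule s_lim)
  also have "(LINT x|lborel. indicator {0<..<1} x * (x powr (- a) * (1 - x) powr (- b))) = Beta (1 - b) (1 - a)"
  proof -
    have "(LINT x|lborel. indicator {0<..<1} x * (x powr (- a) * (1 - x) powr (- b))) =
        (LINT x:{0..1}|lborel. x powr ((1 - a) - 1) * (1 - x) powr ((1 - b) - 1))"
      unfolding set_lebesgue_integral_def by (intro Bochner_Integration.integral_cong) (auto simp: indicator_def)
    also have "\<dots> = integral {0..1} (\<lambda>x. x powr ((1 - a) - 1) * (1 - x) powr ((1 - b) - 1))"
      using exps by (intro set_borel_integral_eq_integral integrable_Beta) auto
    also have "\<dots> = Beta (1 - a) (1 - b)"
      using exps by (intro integral_unique has_integral_Beta_real) auto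
    finally show ?thesis by (simp add: Beta_commute)
  qed
  finally have lim: "((\<lambda>t. LINT x|lborel. s t x) \<longlongrightarrow> Beta (1 - b) (1 - a)) at_top" .
  have eq: "(\<lambda>x. indicator {A..t-A} (0 + t * x) * (f (0 + t * x) * g (t - (0 + t * x)))) = (\<lambda>x. (f t * g t) * s t x)"
    if "2 * A \<le> t" for t
  proof -
    have "0 < f t" "0 < g t" using potter_f[of t t] potter_g[of t t] that A by auto
    then show ?thesis by (auto simp: s_def)
  qed
  have "\<forall>\<^sub>F t in at_top. (LINT x|lborel. s t x) = (LINT u|lborel. indicator {A..t-A} u * (f u * g (t - u))) / (t * f t * g t)"
    using eventually_ge_at_top[of "2 * A"]
  proof eventually_elim
    case (elim t)
    have t: "0 < t" using elim A by simp
    have "0 < f t" "0 < g t" using potter_f[of t t] potter_g[of t t] elim A by auto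
    have "(LINT u|lborel. indicator {A..t-A} u * (f u * g (t - u))) =
        \<bar>t\<bar> *\<^sub>R (LINT x|lborel. indicator {A..t-A} (0 + t * x) * (f (0 + t * x) * g (t - (0 + t * x))))"
      using t by (intro lborel_integral_real_affine) simp
    also have "\<dots> = t * (f t * g t) * (LINT x|lborel. s t x)"
      unfolding eq[OF elim] using t by simp
    finally show ?case using t \<open>0 < f t\<close> \<open>0 < g t\<close> by simp
  qed
  with lim show "((\<lambda>t. (LINT u|lborel. indicator {A..t-A} u * (f u * g (t - u))) / (t * f t * g t))
      \<longlongrightarrow> Beta (1 - b) (1 - a)) at_top"
    by (rule Lim_transform_eventually)
  show "\<forall>\<^sub>F t in at_top. integrable lborel (\<lambda>u. indicator {A..t-A} u * (f u * g (t - u)))"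
    using eventually_ge_at_top[of "2 * A"]
  proof eventually_elim
    case (elim t)
    then have t: "t \<noteq> 0" using A by simp
    have "integrable lborel (s t)"
      using s_bound[OF elim] by (intro Bochner_Integration.integrable_bound[OF w_int s_meas] AE_I2)
        (auto intro: order_trans[OF _ abs_ge_self])
    then have "integrable lborel (\<lambda>x. (f t * g t) * s t x)" by simp
    then show ?case
      unfolding eq[OF elim, symmetric]
      by (subst (asm) lborel_integrable_real_affine_iff[OF t, where f="\<lambda>u. indicator {A..t-A} u * (f u * g (t - u))"])
  qed
qed

text \<open>The integral runs over the whole line because both functions vanish on the negative half-line, so that it is
  an integral over \<open>0 < u < t\<close>. The middle part is of exact order \<open>t * f t * g t\<close>, and the end pieces are at most of
  order \<open>g t\<close> and \<open>f t\<close>.\<close>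

theorem convolution_asymp_equiv:
  fixes f g :: "real \<Rightarrow> real"
  assumes f: "\<And>u. 0 \<le> f u" "\<And>u. u \<le> 0 \<Longrightarrow> f u = 0" "\<And>A. integrable lborel (\<lambda>u. indicator {..<A} u * f u)"
    and g: "\<And>u. 0 \<le> g u" "\<And>u. u \<le> 0 \<Longrightarrow> g u = 0" "\<And>A. integrable lborel (\<lambda>u. indicator {..<A} u * g u)"
    and meas[measurable]: "f \<in> borel_measurable borel" "g \<in> borel_measurable borel"
    and rv: "regularly_varying f (-a)" "regularly_varying g (-b)"
    and ab: "0 \<le> a" "a < 1" "0 \<le> b" "b < 1"
  shows "((\<lambda>t. (LINT u|lborel. f u * g (t - u)) / (t * f t * g t)) \<longlongrightarrow> Beta (1 - b) (1 - a)) at_top"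
proof -
  \<comment> \<open>Room for the loss in the Potter bounds: both exponents must stay below 1.\<close>
  define \<delta> where "\<delta> = min (1 - a) (1 - b) / 2"
  have \<delta>: "0 < \<delta>" "\<delta> + a < 1" "\<delta> + b < 1" using ab by (auto simp: \<delta>_def min_def field_simps)
  define C :: real where "C = 4 * exp 2"
  have C: "0 \<le> C" by (simp add: C_def)
  obtain A1 where A1: "1 \<le> A1" "\<And>x y. A1 \<le> y \<Longrightarrow> y \<le> x \<Longrightarrow> 0 < f x \<and> f y \<le> C * (x / y) powr (\<delta> + a) * f x"
    using regularly_varying_potter[OF rv(1) \<delta>(1)] by (auto simp: C_def)
  obtain A2 where A2: "1 \<le> A2" "\<And>x y. A2 \<le> y \<Longrightarrow> y \<le> x \<Longrightarrow> 0 < g x \<and> g y \<le> C * (x / y) powr (\<delta> + b) * g x"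
    using regularly_varying_potter[OF rv(2) \<delta>(1)] by (auto simp: C_def)
  define A where "A = max A1 A2"
  have A: "1 \<le> A" using A1(1) by (simp add: A_def)
  have pf: "0 < f x \<and> f y \<le> C * (x / y) powr (\<delta> + a) * f x" if "A \<le> y" "y \<le> x" for x y
    using A1(2)[of y x] that by (simp add: A_def)
  have pg: "0 < g x \<and> g y \<le> C * (x / y) powr (\<delta> + b) * g x" if "A \<le> y" "y \<le> x" for x y
    using A2(2)[of y x] that by (simp add: A_def)
  define J where "J t = (LINT u|lborel. f u * g (t - u))" for t
  define J1 where "J1 t = (LINT u|lborel. indicator {..<A} u * (f u * g (t - u)))" for t
  define J2 where "J2 t = (LINT u|lborel. indicator {A..t-A} u * (f u * g (t - u)))" for t
  define J3 where "J3 t = (LINT u|lborel. indicator {..<A} u * (g u * f (t - u)))" for t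
  note edge1 = convolution_edge[OF f(1,2,3) meas g(1) conjunct2[OF pg] A _ C]
  note edge3 = convolution_edge[OF g(1,2,3) meas(2,1) f(1) conjunct2[OF pf] A _ C]
  have J1_lim: "((\<lambda>t. J1 t / (t * f t * g t)) \<longlongrightarrow> 0) at_top"
  proof (rule tendsto_sandwich[where f="\<lambda>_. 0"])
    show "((\<lambda>t. (C * 2 powr (\<delta> + b) * (LINT u|lborel. indicator {..<A} u * f u)) / (t * f t)) \<longlongrightarrow> 0) at_top"
      using regularly_varying_times_id_at_top[OF rv(1)] ab by (intro tendsto_divide_0[OF tendsto_const] filterlim_at_top_imp_at_infinity) auto
    show "\<forall>\<^sub>F t in at_top. J1 t / (t * f t * g t) \<le> (C * 2 powr (\<delta> + b) * (LINT u|lborel. indicator {..<A} u * f u)) / (t * f t)"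
      using eventually_ge_at_top[of "2 * A"]
    proof eventually_elim
      case (elim t)
      have "0 < t" "0 < f t" "0 < g t" using pf[of t t] pg[of t t] elim A by auto
      moreover have "J1 t \<le> C * 2 powr (\<delta> + b) * g t * (LINT u|lborel. indicator {..<A} u * f u)"
        unfolding J1_def using elim \<delta> ab by (intro edge1(2)) auto
      ultimately show ?case by (simp add: field_simps)
    qed
    show "\<forall>\<^sub>F t in at_top. 0 \<le> J1 t / (t * f t * g t)"
      using eventually_ge_at_top[of 0]
    proof eventually_elim
      case (elim t)
      have "0 \<le> J1 t" unfolding J1_def using f(1) g(1) by (intro Bochner_Integration.integral_nonneg) auto
      with elim f(1) g(1) show ?case by (intro divide_nonneg_nonneg mult_nonneg_nonneg) auto
    qed
  qed simp
  have J3_lim: "((\<lambda>t. J3 t / (t * f t * g t)) \<longlongrightarrow> 0) at_top"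
  proof (rule tendsto_sandwich[where f="\<lambda>_. 0"])
    show "((\<lambda>t. (C * 2 powr (\<delta> + a) * (LINT u|lborel. indicator {..<A} u * g u)) / (t * g t)) \<longlongrightarrow> 0) at_top"
      using regularly_varying_times_id_at_top[OF rv(2)] ab by (intro tendsto_divide_0[OF tendsto_const] filterlim_at_top_imp_at_infinity) auto
    show "\<forall>\<^sub>F t in at_top. J3 t / (t * f t * g t) \<le> (C * 2 powr (\<delta> + a) * (LINT u|lborel. indicator {..<A} u * g u)) / (t * g t)"
      using eventually_ge_at_top[of "2 * A"]
    proof eventually_elim
      case (elim t)
      have "0 < t" "0 < f t" "0 < g t" using pf[of t t] pg[of t t] elim A by auto
      moreover have "J3 t \<le> C * 2 powr (\<delta> + a) * f t * (LINT u|lborel. indicator {..<A} u * g u)"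
        unfolding J3_def using elim \<delta> ab by (intro edge3(2)) auto
      ultimately show ?case by (simp add: field_simps)
    qed
    show "\<forall>\<^sub>F t in at_top. 0 \<le> J3 t / (t * f t * g t)"
      using eventually_ge_at_top[of 0]
    proof eventually_elim
      case (elim t)
      have "0 \<le> J3 t" unfolding J3_def using f(1) g(1) by (intro Bochner_Integration.integral_nonneg) auto
      with elim f(1) g(1) show ?case by (intro divide_nonneg_nonneg mult_nonneg_nonneg) auto
    qed
  qed simp
  note middle = convolution_middle[OF f(1) g(1) meas rv pf pg A C]
  have J2_lim: "((\<lambda>t. J2 t / (t * f t * g t)) \<longlongrightarrow> Beta (1 - b) (1 - a)) at_top"
    unfolding J2_def using \<delta> ab by (intro middle(1)) auto
  have "\<forall>\<^sub>F t in at_top. integrable lborel (\<lambda>u. indicator {A..t-A} u * (f u * g (t - u)))"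
    using \<delta> ab by (intro middle(2)) auto
  then have "\<forall>\<^sub>F t in at_top. J t = J1 t + J2 t + J3 t"
    using eventually_ge_at_top[of "2 * A"]
  proof eventually_elim
    case (elim t)
    have i1: "integrable lborel (\<lambda>u. indicator {..<A} u * (f u * g (t - u)))"
      using elim \<delta> ab by (intro edge1(1)) auto
    have "integrable lborel (\<lambda>u. indicator {..<A} u * (g u * f (t - u)))"
      using elim \<delta> ab by (intro edge3(1)) auto
    moreover have flip: "(\<lambda>u. indicator {t-A<..} (t + (-1) * u) * (f (t + (-1) * u) * g (t - (t + (-1) * u)))) =
        (\<lambda>u. indicator {..<A} u * (g u * f (t - u)))"
      by (auto simp: indicator_def)
    ultimately have i3: "integrable lborel (\<lambda>u. indicator {t-A<..} u * (f u * g (t - u)))"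
      by (subst lborel_integrable_real_affine_iff[of "-1" _ t, symmetric]) auto
    have J3: "(LINT u|lborel. indicator {t-A<..} u * (f u * g (t - u))) = J3 t"
      unfolding J3_def flip[symmetric] by (subst lborel_integral_real_affine[of "-1" _ t]) auto
    have "J t = (LINT u|lborel. indicator {..<A} u * (f u * g (t - u)) + indicator {A..t-A} u * (f u * g (t - u)) +
        indicator {t-A<..} u * (f u * g (t - u)))"
      unfolding J_def using elim(2) by (intro Bochner_Integration.integral_cong) (auto simp: indicator_def)
    then show ?case
      using i1 i3 elim(1) by (simp add: J1_def J2_def J3)
  qed
  then have "\<forall>\<^sub>F t in at_top. J1 t / (t * f t * g t) + J2 t / (t * f t * g t) + J3 t / (t * f t * g t) = J t / (t * f t * g t)"
    by eventually_elim (simp add: add_divide_distrib)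
  moreover have "((\<lambda>t. J1 t / (t * f t * g t) + J2 t / (t * f t * g t) + J3 t / (t * f t * g t)) \<longlongrightarrow>
      0 + Beta (1 - b) (1 - a) + 0) at_top"
    using J1_lim J2_lim J3_lim by (intro tendsto_add)
  ultimately show ?thesis
    unfolding J_def by (simp add: Lim_transform_eventually)
qed

lemma Beta_reflection:
  fixes x :: real
  shows "Beta x (1 - x) = pi / sin (pi * x)"
proof -
  have "complex_of_real (Beta x (1 - x)) = Gamma (of_real x) * Gamma (1 - of_real x)"
    by (simp add: Beta_def Gamma_complex_of_real[symmetric])
  also have "\<dots> = of_real (pi / sin (pi * x))"
    by (simp add: Gamma_reflection_complex sin_of_real[symmetric])
  finally show ?thesis by (simp only: of_real_eq_iff)
qed

section \<open>The family tree of one particle\<close>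

text \<open>The cardinality of an infinite set is 0, hence both emptiness and infiniteness have to be recognised;
  a set of elements of a countable type is finite iff their codes are bounded.\<close>

lemma pred_card_eq_0_of_countable:
  fixes A :: "'a \<Rightarrow> 'c :: countable set"
  assumes [measurable]: "\<And>u. Measurable.pred M (\<lambda>\<omega>. u \<in> A \<omega>)"
  shows "Measurable.pred M (\<lambda>\<omega>. card (A \<omega>) = 0)"
proof -
  have fin: "finite B \<longleftrightarrow> (\<exists>n. \<forall>u. u \<in> B \<longrightarrow> to_nat u \<le> n)" for B :: "'c set"
  proof
    assume "finite B"
    then show "\<exists>n. \<forall>u. u \<in> B \<longrightarrow> to_nat u \<le> n"
      by (intro exI[of _ "Max (to_nat ` B)"]) auto
  next
    assume "\<exists>n. \<forall>u. u \<in> B \<longrightarrow> to_nat u \<le> n"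
    then obtain n where "to_nat ` B \<subseteq> {..n}" by auto
    then have "finite (to_nat ` B)" by (rule finite_subset) simp
    then show "finite B" by (rule finite_imageD) (auto intro: inj_on_subset)
  qed
  have "card (A \<omega>) = 0 \<longleftrightarrow> (\<forall>u. u \<notin> A \<omega>) \<or> \<not> (\<exists>n. \<forall>u. u \<in> A \<omega> \<longrightarrow> to_nat u \<le> n)" for \<omega>
    unfolding fin[symmetric] by (auto simp: card_eq_0_iff)
  moreover have "Measurable.pred M (\<lambda>\<omega>. (\<forall>u. u \<notin> A \<omega>) \<or> \<not> (\<exists>n. \<forall>u. u \<in> A \<omega> \<longrightarrow> to_nat u \<le> n))"
    by measurable
  ultimately show ?thesis by simp
qed

text \<open>The time may be random. This gives measurability of events at the random age of an immigrant group,
  everywhere and not merely up to a null set.\<close>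

lemma pred_no_alive:
  assumes [measurable]: "\<And>u. T u \<in> borel_measurable M"
    "\<And>u. X u \<in> measurable M (count_space UNIV)" "\<tau> \<in> borel_measurable M"
  shows "Measurable.pred M (\<lambda>\<omega>. card (alive_at T X (\<tau> \<omega>) \<omega>) = 0)"
  by (rule pred_card_eq_0_of_countable)
     (unfold alive_at_def in_tree_def birth_time_def mem_Collect_eq, measurable)

text \<open>The joint law of all lifetimes and offspring numbers is the product measure, so the probability of having no
  living particle depends on \<open>\<mu>\<close> and \<open>p\<close> alone. This is how the copies \<open>Z k j\<close> are seen to be
  identically distributed.\<close>

lemma extinction_probability_product_form:
  assumes "prob_space M" and Z: "markov_branching_process M \<mu> p Z" and t: "0 \<le> t"
  shows "measure M {\<omega>\<in>space M. Z t \<omega> = 0} =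
    measure (Pi\<^sub>M UNIV (case_sum (\<lambda>_. density lborel (exponential_density \<mu>))
                              (\<lambda>_. distr (measure_pmf p) borel real)))
      {x \<in> space (Pi\<^sub>M UNIV (\<lambda>_. borel)). card (alive_at (\<lambda>u x. x (Inl u)) (\<lambda>u x. nat \<lfloor>x (Inr u)\<rfloor>) t x) = 0}"
    (is "_ = measure ?P ?E")
proof -
  interpret prob_space M by fact
  obtain T X where T: "\<And>u. distributed M lborel (T u) (exponential_density \<mu>)"
    and X: "\<And>u. X u \<in> measurable M (count_space UNIV)"
      "\<And>u. distr M (count_space UNIV) (X u) = measure_pmf p"
    and ind: "indep_vars (\<lambda>_. borel) (case_sum T (\<lambda>u \<omega>. real (X u \<omega>))) (UNIV :: (nat list + nat list) set)"
    and card: "\<And>\<omega>. \<omega> \<in> space M \<Longrightarrow> Z t \<omega> = card (alive_at T X t \<omega>)"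
    using Z t unfolding markov_branching_process_def by blast
  define V where "V = case_sum T (\<lambda>u \<omega>. real (X u \<omega>))"
  have T_meas[measurable]: "T u \<in> borel_measurable M" for u
    using T[of u] by (simp add: distributed_def)
  note X(1)[measurable]
  have V_meas[measurable]: "V i \<in> borel_measurable M" for i
    unfolding V_def by (cases i) auto
  have "distr M borel (T u) = density lborel (exponential_density \<mu>)" for u
    unfolding distributed_distr_eq_density[OF T[of u], symmetric] by (rule distr_cong) auto
  moreover have "distr M borel (\<lambda>\<omega>. real (X u \<omega>)) = distr (measure_pmf p) borel real" for u
    unfolding X(2)[of u, symmetric] by (subst distr_distr) (auto simp: comp_def)
  ultimately have law: "distr M borel (V i) =
      case_sum (\<lambda>_. density lborel (exponential_density \<mu>)) (\<lambda>_. distr (measure_pmf p) borel real) i" for i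
    unfolding V_def by (cases i) auto
  have "distr M (Pi\<^sub>M UNIV (\<lambda>_. borel)) (\<lambda>x. \<lambda>i\<in>UNIV. V i x) = (Pi\<^sub>M UNIV (\<lambda>i. distr M borel (V i)))"
    using ind by (subst indep_vars_iff_distr_eq_PiM[symmetric]) (auto simp: V_def[symmetric])
  then have P: "distr M (Pi\<^sub>M UNIV (\<lambda>_. borel)) (\<lambda>x. \<lambda>i\<in>UNIV. V i x) = ?P"
    by (simp add: law)
  have E[measurable]: "?E \<in> sets (Pi\<^sub>M UNIV (\<lambda>_. borel))"
    by (subst pred_def[symmetric], rule pred_no_alive) measurable
  have "measure ?P ?E = measure M ((\<lambda>x. \<lambda>i\<in>UNIV. V i x) -` ?E \<inter> space M)"
    unfolding P[symmetric] by (rule measure_distr) measurable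
  also have "(\<lambda>x. \<lambda>i\<in>UNIV. V i x) -` ?E \<inter> space M = {\<omega>\<in>space M. Z t \<omega> = 0}"
    by (auto simp: card V_def space_PiM alive_at_def in_tree_def birth_time_def)
  finally show ?thesis by simp
qed

lemma extinction_probability_unique:
  assumes "prob_space M" "markov_branching_process M \<mu> p Z" "markov_branching_process M \<mu> p Z'" "0 \<le> t"
  shows "measure M {\<omega>\<in>space M. Z t \<omega> = 0} = measure M {\<omega>\<in>space M. Z' t \<omega> = 0}"
  using assms by (simp add: extinction_probability_product_form)

text \<open>Splitting off the first letter of a word gives a recursion in \<open>n\<close>. The words of length \<open>n\<close> will be the labels of
  generation \<open>n\<close>.\<close>

lemma nn_integral_lists_prod:
  fixes b :: "nat \<Rightarrow> ennreal"
  shows "(\<integral>\<^sup>+u. (\<Prod>i<length u. b (u ! i)) * indicator {u. length u = n} u \<partial>count_space UNIV)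
    = (\<integral>\<^sup>+k. b k \<partial>count_space UNIV) ^ n"
proof (induction n)
  case 0
  have "(\<integral>\<^sup>+u. (\<Prod>i<length u. b (u ! i)) * indicator {u. length u = 0} u \<partial>count_space UNIV) =
    (\<integral>\<^sup>+u. indicator {[] :: nat list} u \<partial>count_space UNIV)"
    by (intro nn_integral_cong) (auto simp: indicator_def)
  then show ?case by simp
next
  case (Suc n)
  let ?f = "\<lambda>n u. (\<Prod>i<length u. b (u ! i)) * indicator {u. length u = n} u"
  have bij: "bij_betw (\<lambda>(k, u). k # u) UNIV (range (\<lambda>(k, u). k # u))"
    by (intro inj_on_imp_bij_betw) (auto simp: inj_on_def)
  have "(\<integral>\<^sup>+u. ?f (Suc n) u \<partial>count_space UNIV) =
        (\<integral>\<^sup>+u. ?f (Suc n) u \<partial>count_space (range (\<lambda>(k, u). k # u)))"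
  proof (rule nn_integral_count_space_eq)
    fix u :: "nat list" assume "u \<in> UNIV - range (\<lambda>(k, u). k # u)"
    then have "u = []" by (cases u) (auto simp: image_iff)
    then show "?f (Suc n) u = 0" by simp
  qed auto
  also have "\<dots> = (\<integral>\<^sup>+x. ?f (Suc n) ((\<lambda>(k, u). k # u) x) \<partial>count_space UNIV)"
    by (rule nn_integral_bij_count_space[OF bij, symmetric])
  also have "\<dots> = (\<integral>\<^sup>+x. b (fst x) * ?f n (snd x) \<partial>count_space UNIV)"
    by (intro nn_integral_cong)
       (auto simp: prod.lessThan_Suc_shift indicator_def simp del: prod.lessThan_Suc)
  also have "\<dots> = (\<integral>\<^sup>+k. \<integral>\<^sup>+u. b k * ?f n u \<partial>count_space UNIV \<partial>count_space UNIV)"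
    by (subst nn_integral_fst_count_space[symmetric]) simp
  also have "\<dots> = (\<integral>\<^sup>+k. b k \<partial>count_space UNIV) * (\<integral>\<^sup>+u. ?f n u \<partial>count_space UNIV)"
    by (simp add: nn_integral_cmult nn_integral_multc)
  finally show ?case using Suc.IH by simp
qed

lemma exponential_laplace_less_1:
  assumes "prob_space M" "0 < \<mu>" and T: "distributed M lborel T (exponential_density \<mu>)"
  shows "(\<integral>\<^sup>+\<omega>. ennreal (exp (- T \<omega>)) \<partial>M) < 1"
proof -
  interpret prob_space M by fact
  have [measurable]: "T \<in> borel_measurable M" using T by (simp add: distributed_def)
  have "AE x in distr M lborel T. 0 < x"
    unfolding distributed_distr_eq_density[OF T]
    by (subst AE_density) (auto simp: exponential_density_def intro!: AE_I[OF _ emeasure_lborel_singleton[of 0]] )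
  then have pos: "AE \<omega> in M. 0 < T \<omega>" by (subst (asm) AE_distr_iff) auto
  have "integrable M (\<lambda>\<omega>. exp (- T \<omega>))"
    using pos by (intro integrable_const_bound[of _ 1]) auto
  moreover then have "(LINT \<omega>|M. exp (- T \<omega>)) < (LINT \<omega>|M. 1)"
    using pos by (intro integral_less_AE_space) (auto simp: emeasure_space_1)
  ultimately show ?thesis
    by (subst nn_integral_eq_integral) (auto simp: prob_space ennreal_less_one_iff)
qed

lemma mean_one_tail_sum:
  assumes "mean_one p"
  shows "(\<integral>\<^sup>+k. emeasure (measure_pmf p) {x. k < x} \<partial>count_space UNIV) = 1"
proof -
  have "(\<integral>\<^sup>+k. emeasure (measure_pmf p) {x. k < x} \<partial>count_space UNIV) =
        (\<integral>\<^sup>+k. (\<integral>\<^sup>+x. indicator {x. k < x} x \<partial>measure_pmf p) \<partial>count_space UNIV)"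
    by simp
  also have "\<dots> = (\<integral>\<^sup>+x. (\<integral>\<^sup>+k. indicator {x. k < x} x \<partial>count_space UNIV) \<partial>measure_pmf p)"
    by (rule nn_integral_count_space_nn_integral[symmetric]) auto
  also have "\<dots> = (\<integral>\<^sup>+x. ennreal (real x) \<partial>measure_pmf p)"
  proof (intro nn_integral_cong)
    fix x :: nat
    have "(\<integral>\<^sup>+k. indicator {x. k < x} x \<partial>count_space UNIV) = (\<integral>\<^sup>+k. indicator {..<x} k \<partial>count_space UNIV)"
      by (intro nn_integral_cong) (auto simp: indicator_def)
    then show "(\<integral>\<^sup>+k. indicator {x. k < x} x \<partial>count_space UNIV) = ennreal (real x)"
      by (simp add: ennreal_of_nat_eq_real_of_nat)
  qed
  also have "\<dots> = 1"
    using assms by (subst nn_integral_eq_integral) (auto simp: mean_one_def)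
  finally show ?thesis .
qed

text \<open>The process does not explode. The sum of \<open>exp (- birth time)\<close> over all particles of the tree has
  finite expectation: by independence generation \<open>n\<close> contributes \<open>c ^ n\<close>, where \<open>c < 1\<close> is the Laplace
  transform of the lifetime at 1 and the expected number of particles in each generation is 1. Each particle
  born before \<open>t\<close> contributes at least \<open>exp (- t)\<close> to this sum, so there are finitely many of them.\<close>

lemma AE_finitely_many_births:
  assumes "prob_space M" "0 < \<mu>" and T: "\<And>u. distributed M lborel (T u) (exponential_density \<mu>)"
    and X: "\<And>u. X u \<in> measurable M (count_space UNIV)"
      "\<And>u. distr M (count_space UNIV) (X u) = measure_pmf p"
    and ind: "prob_space.indep_vars M (\<lambda>_. borel) (case_sum T (\<lambda>u \<omega>. real (X u \<omega>))) (UNIV :: (nat list + nat list) set)"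
    and mean: "mean_one p"
  shows "AE \<omega> in M. \<forall>t. finite {u. in_tree X \<omega> u \<and> birth_time T \<omega> u \<le> t}"
proof -
  interpret prob_space M by fact
  have T_meas[measurable]: "T u \<in> borel_measurable M" for u
    using T[of u] by (simp add: distributed_def)
  note X(1)[measurable]
  define c where "c = (\<integral>\<^sup>+\<omega>. ennreal (exp (- T [] \<omega>)) \<partial>M)"
  have c1: "c < 1" unfolding c_def by (rule exponential_laplace_less_1) fact+
  have c: "(\<integral>\<^sup>+\<omega>. ennreal (exp (- T u \<omega>)) \<partial>M) = c" for u
    unfolding c_def
    by (subst (1 2) distributed_nn_integral[OF T, symmetric]) auto
  define a where "a k = emeasure (measure_pmf p) {x. k < x}" for k :: nat
  have a: "(\<integral>\<^sup>+\<omega>. (if real k < real (X u \<omega>) then 1 else 0) \<partial>M) = a k" for k u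
  proof -
    have "a k = (\<integral>\<^sup>+x. indicator {x. k < x} x \<partial>distr M (count_space UNIV) (X u))"
      unfolding a_def X(2) by simp
    also have "\<dots> = (\<integral>\<^sup>+\<omega>. (if real k < real (X u \<omega>) then 1 else 0) \<partial>M)"
      by (subst nn_integral_distr) (auto intro!: nn_integral_cong simp: indicator_def)
    finally show ?thesis by simp
  qed
  define W where "W u \<omega> = (\<Prod>i<length u. ennreal (exp (- T (take i u) \<omega>)) *
      (if real (u ! i) < real (X (take i u) \<omega>) then 1 else 0))" for u \<omega>
  have [measurable]: "W u \<in> borel_measurable M" for u
    unfolding W_def by measurable
  have W_eq: "W u \<omega> = ennreal (exp (- birth_time T \<omega> u)) * (if in_tree X \<omega> u then 1 else 0)" for u \<omega>
  proof -
    have "(\<Prod>i<length u. ennreal (exp (- T (take i u) \<omega>))) = ennreal (exp (- birth_time T \<omega> u))"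
      unfolding birth_time_def by (simp add: prod_ennreal exp_sum sum_negf[symmetric])
    moreover have "(\<Prod>i<length u. (if real (u ! i) < real (X (take i u) \<omega>) then 1 else 0 :: ennreal)) =
        (if in_tree X \<omega> u then 1 else 0)"
      unfolding in_tree_def by (auto intro!: prod_zero prod.neutral)
    ultimately show ?thesis unfolding W_def by (simp add: prod.distrib)
  qed
  have EW: "(\<integral>\<^sup>+\<omega>. W u \<omega> \<partial>M) = (\<Prod>i<length u. c * a (u ! i))" for u
  proof -
    \<comment> \<open>The ancestors of \<open>u\<close>, told apart by their length: the ancestor of length \<open>i\<close> must have more than \<open>u ! i\<close> children.\<close>
    define D where "D = (\<lambda>i. take i u) ` {..<length u}"
    have inj: "inj_on (\<lambda>i. take i u) {..<length u}"
      by (rule inj_onI) (metis length_take lessThan_iff min.absorb4)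
    define g :: "nat list + nat list \<Rightarrow> real \<Rightarrow> ennreal" where "g = (\<lambda>i x. case i of Inl v \<Rightarrow> ennreal (exp (- x))
        | Inr v \<Rightarrow> (if real (u ! length v) < x then 1 else 0))"
    define U where "U = (\<lambda>i \<omega>. g i (case_sum T (\<lambda>u \<omega>. real (X u \<omega>)) i \<omega>))"
    have indU: "indep_vars (\<lambda>_. borel) U (D <+> D)"
      unfolding U_def
    proof (rule indep_vars_compose2[OF indep_vars_subset[OF ind]])
      fix i :: "nat list + nat list"
      show "g i \<in> borel_measurable borel" unfolding g_def by (cases i) simp_all
    qed auto
    have fin: "finite D" unfolding D_def by simp
    have "W u \<omega> = (\<Prod>i\<in>D <+> D. U i \<omega>)" for \<omega>
      using fin
      by (simp add: prod.Plus U_def g_def D_def prod.reindex[OF inj] W_def prod.distrib)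
    then have "(\<integral>\<^sup>+\<omega>. W u \<omega> \<partial>M) = (\<Prod>i\<in>D <+> D. \<integral>\<^sup>+\<omega>. U i \<omega> \<partial>M)"
      using indU fin by (simp add: indep_vars_nn_integral)
    also have "\<dots> = (\<Prod>i<length u. c * a (u ! i))"
      using fin
      by (simp add: prod.Plus U_def g_def D_def prod.reindex[OF inj] prod.distrib c a[simplified] card_image[OF inj])
    finally show ?thesis .
  qed
  have "(\<integral>\<^sup>+\<omega>. (\<integral>\<^sup>+u. W u \<omega> \<partial>count_space UNIV) \<partial>M) = (\<integral>\<^sup>+u. (\<integral>\<^sup>+\<omega>. W u \<omega> \<partial>M) \<partial>count_space UNIV)"
    by (rule nn_integral_count_space_nn_integral) auto
  also have "\<dots> = (\<integral>\<^sup>+u. (\<Sum>n. (\<Prod>i<length u. c * a (u ! i)) * indicator {u. length u = n} u) \<partial>count_space UNIV)"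
  proof (intro nn_integral_cong)
    fix u :: "nat list"
    have "(\<Sum>n. (\<Prod>i<length u. c * a (u ! i)) * indicator {u. length u = n} u) =
      (\<Sum>n\<in>{length u}. (\<Prod>i<length u. c * a (u ! i)) * indicator {u. length u = n} u)"
      by (rule suminf_finite) auto
    then show "(\<integral>\<^sup>+\<omega>. W u \<omega> \<partial>M) = (\<Sum>n. (\<Prod>i<length u. c * a (u ! i)) * indicator {u. length u = n} u)"
      by (simp add: EW)
  qed
  also have "\<dots> = (\<Sum>n. (\<integral>\<^sup>+k. c * a k \<partial>count_space UNIV) ^ n)"
    by (subst nn_integral_suminf) (auto simp: nn_integral_lists_prod[of "\<lambda>k. c * a k", simplified])
  also have "(\<integral>\<^sup>+k. c * a k \<partial>count_space UNIV) = c"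
    using mean_one_tail_sum[OF mean] by (simp add: nn_integral_cmult a_def)
  also have "(\<Sum>n. c ^ n) < \<infinity>"
  proof -
    obtain c' where c': "c = ennreal c'" "0 \<le> c'" "c' < 1"
      using c1 by (cases c) (auto simp: ennreal_less_one_iff)
    then show ?thesis
      by (simp add: ennreal_power suminf_ennreal2 summable_geometric)
  qed
  finally have fin: "(\<integral>\<^sup>+\<omega>. (\<integral>\<^sup>+u. W u \<omega> \<partial>count_space UNIV) \<partial>M) < \<infinity>" .
  have "(\<integral>\<^sup>+u. W u \<omega> \<partial>count_space UNIV) = (\<Sum>n. W (from_nat_into UNIV n) \<omega>)" for \<omega>
    by (simp add: nn_integral_count_space_nat infinite_UNIV_listI
      nn_integral_bij_count_space[symmetric, OF bij_betw_from_nat_into])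
  then have "(\<lambda>\<omega>. \<integral>\<^sup>+u. W u \<omega> \<partial>count_space UNIV) \<in> borel_measurable M"
    by simp
  with fin have "AE \<omega> in M. (\<integral>\<^sup>+u. W u \<omega> \<partial>count_space UNIV) \<noteq> \<infinity>"
    by (intro nn_integral_PInf_AE) auto
  then show ?thesis
  proof eventually_elim
    case (elim \<omega>)
    show ?case
    proof
      fix t :: real
      let ?B = "{u. in_tree X \<omega> u \<and> birth_time T \<omega> u \<le> t}"
      have "ennreal (exp (- t)) * emeasure (count_space UNIV) ?B =
          (\<integral>\<^sup>+u. ennreal (exp (- t)) * indicator ?B u \<partial>count_space UNIV)"
        by (subst nn_integral_cmult_indicator) auto
      also have "\<dots> \<le> (\<integral>\<^sup>+u. W u \<omega> \<partial>count_space UNIV)"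
        by (intro nn_integral_mono) (auto simp: W_eq indicator_def intro!: ennreal_leI)
      finally have "ennreal (exp (- t)) * emeasure (count_space UNIV) ?B < \<infinity>"
        using elim by (simp add: less_top order_le_less_trans)
      then show "finite ?B"
        by (rule_tac ccontr) (auto simp: ennreal_mult_less_top)
    qed
  qed
qed

text \<open>Until time \<open>s + 1\<close> only finitely many particles are ever alive, and each of them is alive on a half-open
  interval that is closed on the left.\<close>

lemma AE_right_continuous:
  assumes "prob_space M" "0 < \<mu>" "mean_one p" and Z: "markov_branching_process M \<mu> p Z"
  shows "AE \<omega> in M. \<forall>s\<ge>0. \<forall>\<^sub>F s' in at_right s. Z s' \<omega> = Z s \<omega>"
proof -
  interpret prob_space M by fact
  obtain T X where TX: "\<And>u. distributed M lborel (T u) (exponential_density \<mu>)"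
      "\<And>u. X u \<in> measurable M (count_space UNIV)"
      "\<And>u. distr M (count_space UNIV) (X u) = measure_pmf p"
      "indep_vars (\<lambda>_. borel) (case_sum T (\<lambda>u \<omega>. real (X u \<omega>))) (UNIV :: (nat list + nat list) set)"
    and card: "\<And>t \<omega>. 0 \<le> t \<Longrightarrow> \<omega> \<in> space M \<Longrightarrow> Z t \<omega> = card (alive_at T X t \<omega>)"
    using Z unfolding markov_branching_process_def by blast
  have "AE \<omega> in M. \<forall>t. finite {u. in_tree X \<omega> u \<and> birth_time T \<omega> u \<le> t}"
    using AE_finitely_many_births[OF assms(1,2) TX assms(3)] .
  with AE_space show ?thesis
  proof eventually_elim
    case (elim \<omega>)
    show ?case
    proof (intro allI impI)
      fix s :: real assume s: "0 \<le> s"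
      let ?B = "{u. in_tree X \<omega> u \<and> birth_time T \<omega> u \<le> s + 1}"
      have "\<forall>\<^sub>F s' in at_right s. (u \<in> alive_at T X s' \<omega>) = (u \<in> alive_at T X s \<omega>)" for u
      proof -
        have above: "\<forall>\<^sub>F s' in at_right s. s < s'" by (rule eventually_at_right_less)
        have below: "\<forall>\<^sub>F s' in at_right s. s' < y" if "s < y" for y
          using eventually_at_right_real[OF that] by eventually_elim auto
        have "\<forall>\<^sub>F s' in at_right s. (y \<le> s') = (y \<le> s)" for y
        proof (cases "y \<le> s")
          case True
          from above show ?thesis by eventually_elim (use True in auto)
        next
          case False
          then have "s < y" by simp
          from below[OF this] show ?thesis by eventually_elim (use False in auto)
        qed
        from this[of "birth_time T \<omega> u"] this[of "birth_time T \<omega> u + T u \<omega>"] show ?thesis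
          unfolding alive_at_def by eventually_elim (auto simp: not_le[symmetric])
      qed
      then have "\<forall>\<^sub>F s' in at_right s. \<forall>u\<in>?B. (u \<in> alive_at T X s' \<omega>) = (u \<in> alive_at T X s \<omega>)"
        using elim by (intro eventually_ball_finite) auto
      moreover have "\<forall>\<^sub>F s' in at_right s. s < s' \<and> s' < s + 1"
        using eventually_at_right_real[of s "s + 1"] by simp
      ultimately show "\<forall>\<^sub>F s' in at_right s. Z s' \<omega> = Z s \<omega>"
      proof eventually_elim
        case (elim s')
        then have "alive_at T X s' \<omega> = alive_at T X s \<omega>"
          unfolding alive_at_def by fastforce
        with elim s \<open>\<omega> \<in> space M\<close> show ?case by (simp add: card)
      qed
    qed
  qed
qed

section \<open>Conditioning on a countable variable, generating functions and grids\<close>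

lemma sets_countable_choice:
  fixes K :: "'a \<Rightarrow> 'd :: countable"
  assumes [measurable]: "K \<in> measurable M (count_space UNIV)" "\<And>d. A d \<in> sets M"
  shows "{\<omega>\<in>space M. \<omega> \<in> A (K \<omega>)} \<in> sets M"
proof -
  have "{\<omega>\<in>space M. \<omega> \<in> A (K \<omega>)} = (\<Union>d. {\<omega>\<in>space M. K \<omega> = d} \<inter> A d)"
    by auto
  also have "\<dots> \<in> sets M" by measurable
  finally show ?thesis .
qed

text \<open>The law of total probability over the values of \<open>K\<close>: if the event \<open>A d\<close> has conditional probability
  \<open>\<phi> d\<close> given \<open>K = d\<close>, then the event selected by \<open>K\<close> has probability equal to the mean of \<open>\<phi> K\<close>.\<close>

lemma (in prob_space) prob_countable_decomposition:
  fixes K :: "'a \<Rightarrow> 'd :: countable" and \<phi> :: "'d \<Rightarrow> real"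
  assumes K[measurable]: "K \<in> measurable M (count_space UNIV)"
    and A[measurable]: "\<And>d. A d \<in> sets M"
    and \<phi>: "\<And>d. 0 \<le> \<phi> d" "\<And>d. \<phi> d \<le> 1"
    and cond: "\<And>d. prob ({\<omega>\<in>space M. K \<omega> = d} \<inter> A d) = prob {\<omega>\<in>space M. K \<omega> = d} * \<phi> d"
  shows "prob {\<omega>\<in>space M. \<omega> \<in> A (K \<omega>)} = expectation (\<lambda>\<omega>. \<phi> (K \<omega>))"
proof -
  have single: "f (K \<omega>) = (\<integral>\<^sup>+d. indicator {\<omega>\<in>space M. K \<omega> = d} \<omega> * f d \<partial>count_space UNIV)"
    if "\<omega> \<in> space M" for f \<omega>
  proof -
    have "(\<integral>\<^sup>+d. indicator {\<omega>\<in>space M. K \<omega> = d} \<omega> * f d \<partial>count_space UNIV) =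
       (\<integral>\<^sup>+d. f (K \<omega>) * indicator {K \<omega>} d \<partial>count_space UNIV)"
      using that by (intro nn_integral_cong) (auto simp: indicator_def)
    then show ?thesis by simp
  qed
  note sets_countable_choice[OF K A, measurable]
  have "emeasure M {\<omega>\<in>space M. \<omega> \<in> A (K \<omega>)} = (\<integral>\<^sup>+\<omega>. indicator (A (K \<omega>)) \<omega> \<partial>M)"
    by (subst nn_integral_indicator[symmetric], measurable) (rule nn_integral_cong, simp add: indicator_def)
  also have "\<dots> = (\<integral>\<^sup>+\<omega>. \<integral>\<^sup>+d. indicator {\<omega>\<in>space M. K \<omega> = d} \<omega> * indicator (A d) \<omega> \<partial>count_space UNIV \<partial>M)"
    by (intro nn_integral_cong) (rule single)
  also have "\<dots> = (\<integral>\<^sup>+d. \<integral>\<^sup>+\<omega>. indicator {\<omega>\<in>space M. K \<omega> = d} \<omega> * indicator (A d) \<omega> \<partial>M \<partial>count_space UNIV)"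
    by (rule nn_integral_count_space_nn_integral) auto
  also have "\<dots> = (\<integral>\<^sup>+d. \<integral>\<^sup>+\<omega>. indicator {\<omega>\<in>space M. K \<omega> = d} \<omega> * ennreal (\<phi> d) \<partial>M \<partial>count_space UNIV)"
  proof (rule nn_integral_cong)
    fix d
    have "(\<integral>\<^sup>+\<omega>. indicator {\<omega>\<in>space M. K \<omega> = d} \<omega> * indicator (A d) \<omega> \<partial>M) =
        (\<integral>\<^sup>+\<omega>. indicator ({\<omega>\<in>space M. K \<omega> = d} \<inter> A d) \<omega> \<partial>M)"
      by (intro nn_integral_cong) (auto simp: indicator_def)
    also have "\<dots> = emeasure M ({\<omega>\<in>space M. K \<omega> = d} \<inter> A d)" by (rule nn_integral_indicator) measurable
    also have "\<dots> = (\<integral>\<^sup>+\<omega>. indicator {\<omega>\<in>space M. K \<omega> = d} \<omega> * ennreal (\<phi> d) \<partial>M)"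
      using cond[of d] \<phi> by (simp add: nn_integral_multc emeasure_eq_measure ennreal_mult)
    finally show "(\<integral>\<^sup>+\<omega>. indicator {\<omega>\<in>space M. K \<omega> = d} \<omega> * indicator (A d) \<omega> \<partial>M) =
      (\<integral>\<^sup>+\<omega>. indicator {\<omega>\<in>space M. K \<omega> = d} \<omega> * ennreal (\<phi> d) \<partial>M)" .
  qed
  also have "\<dots> = (\<integral>\<^sup>+\<omega>. \<integral>\<^sup>+d. indicator {\<omega>\<in>space M. K \<omega> = d} \<omega> * ennreal (\<phi> d) \<partial>count_space UNIV \<partial>M)"
    by (rule nn_integral_count_space_nn_integral[symmetric]) auto
  also have "\<dots> = (\<integral>\<^sup>+\<omega>. ennreal (\<phi> (K \<omega>)) \<partial>M)"
    by (intro nn_integral_cong) (rule single[symmetric])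
  also have "\<dots> = ennreal (expectation (\<lambda>\<omega>. \<phi> (K \<omega>)))"
    using \<phi> by (intro nn_integral_eq_integral integrable_const_bound[of _ 1]) auto
  finally show ?thesis
    using \<phi> by (simp add: emeasure_eq_measure)
qed

lemma (in prob_space) expectation_power_poisson:
  assumes D[measurable]: "D \<in> measurable M (count_space UNIV)" and "0 \<le> m" and w: "0 \<le> w" "w \<le> 1"
    and law: "\<And>n. prob {\<omega>\<in>space M. D \<omega> = n} = exp (- m) * m ^ n / fact n"
  shows "expectation (\<lambda>\<omega>. w ^ D \<omega>) = exp (- m * (1 - w))"
proof -
  have "ennreal (expectation (\<lambda>\<omega>. w ^ D \<omega>)) = (\<integral>\<^sup>+\<omega>. ennreal (w ^ D \<omega>) \<partial>M)"
    using w by (intro nn_integral_eq_integral[symmetric] integrable_const_bound[of _ 1]) (auto simp: power_le_one)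
  also have "\<dots> = (\<integral>\<^sup>+n. ennreal (w ^ n) \<partial>distr M (count_space UNIV) D)"
    by (subst nn_integral_distr) auto
  also have "distr M (count_space UNIV) D = density (count_space UNIV) (\<lambda>n. ennreal (exp (- m) * m ^ n / fact n))"
  proof (rule measure_eqI_countable[of _ UNIV])
    fix n :: nat
    show "emeasure (distr M (count_space UNIV) D) {n} =
      emeasure (density (count_space UNIV) (\<lambda>n. ennreal (exp (- m) * m ^ n / fact n))) {n}"
      using law[of n]
      by (simp add: emeasure_distr emeasure_density emeasure_eq_measure vimage_def Int_def conj_commute)
  qed auto
  also have "(\<integral>\<^sup>+n. ennreal (w ^ n) \<partial>\<dots>) = (\<integral>\<^sup>+n. ennreal (exp (- m) * ((m * w) ^ n / fact n)) \<partial>count_space UNIV)"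
    using assms by (subst nn_integral_density)
      (auto intro!: nn_integral_cong simp: ennreal_mult[symmetric] power_mult_distrib mult_ac)
  also have "\<dots> = ennreal (exp (- m) * exp (m * w))"
  proof -
    have "(\<lambda>n. exp (- m) * ((m * w) ^ n / fact n)) sums (exp (- m) * exp (m * w))"
      using exp_converges[of "m * w"] by (intro sums_mult) (simp add: scaleR_conv_of_real divide_inverse_commute)
    then show ?thesis
      using assms(2,3) by (subst nn_integral_count_space_nat, subst suminf_ennreal_eq) auto
  qed
  also have "\<dots> = exp (- m * (1 - w))"
    by (simp add: exp_add[symmetric] algebra_simps)
  finally show ?thesis
    using w by (simp add: Bochner_Integration.integral_nonneg)
qed

lemma pgf_tendsto:
  assumes "\<And>n. 0 \<le> X n" "\<And>n. X n \<le> 1" "X \<longlonglongrightarrow> x"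
  shows "(\<lambda>n. pgf h (X n)) \<longlonglongrightarrow> pgf h x"
  unfolding pgf_def using assms
  by (intro integral_dominated_convergence[where w="\<lambda>_. 1"])
     (auto intro!: tendsto_power power_le_one)

lemma pgf_bounds:
  assumes "0 \<le> x" "x \<le> 1" shows "0 \<le> pgf h x" "pgf h x \<le> 1"
proof -
  show "0 \<le> pgf h x" using assms unfolding pgf_def by (intro Bochner_Integration.integral_nonneg) auto
  have "pgf h x \<le> measure_pmf.expectation h (\<lambda>_. 1)"
    using assms unfolding pgf_def
    by (intro Bochner_Integration.integral_mono measure_pmf.integrable_const_bound[where B=1]) (auto simp: power_le_one)
  then show "pgf h x \<le> 1" by simp
qed

text \<open>A right-continuous function is the limit of its values at the next grid point to the right.\<close>

lemma borel_measurable_of_right_continuous: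
  fixes f :: "real \<Rightarrow> real"
  assumes rc: "\<And>s X. 0 \<le> s \<Longrightarrow> (\<And>n. s < X n) \<Longrightarrow> X \<longlonglongrightarrow> s \<Longrightarrow> (\<lambda>n. f (X n)) \<longlonglongrightarrow> f s"
  shows "(\<lambda>s. f s * indicator {0..} s) \<in> borel_measurable borel"
proof (rule borel_measurable_LIMSEQ_real)
  let ?X = "\<lambda>n s. real_of_int (\<lfloor>s * real (Suc n)\<rfloor> + 1) / real (Suc n)"
  show "(\<lambda>s. f (?X n s) * indicator {0..} s) \<in> borel_measurable borel" for n
    by measurable
  fix s :: real
  show "(\<lambda>n. f (?X n s) * indicator {0..} s) \<longlonglongrightarrow> f s * indicator {0..} s"
  proof (cases "0 \<le> s")
    case True
    have gt: "s < ?X n s" for n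
      by (simp add: pos_less_divide_eq)
    have le: "?X n s \<le> s + 1 / real (Suc n)" for n
      by (simp add: pos_divide_le_eq distrib_right)
    have "(\<lambda>n. s + 1 / real (Suc n)) \<longlonglongrightarrow> s + 0"
      by (intro tendsto_intros LIMSEQ_Suc lim_1_over_n)
    then have "(\<lambda>n. ?X n s) \<longlonglongrightarrow> s"
      using gt le by (intro tendsto_sandwich[of "\<lambda>_. s" "\<lambda>n. ?X n s" _ "\<lambda>n. s + 1 / real (Suc n)"])
        (auto intro!: always_eventually less_imp_le)
    from rc[OF True gt this] show ?thesis by (intro tendsto_mult tendsto_const)
  qed simp
qed

text \<open>The index \<open>i\<close> of the interval \<open>t * i / N < s \<le> t * (i + 1) / N\<close> that contains \<open>s\<close>. Open on the left and closed on
  the right, the intervals match the increments of the counting process.\<close>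

definition cell :: "nat \<Rightarrow> real \<Rightarrow> real \<Rightarrow> nat" where
  "cell N t s = nat \<lceil>s * real N / t\<rceil> - 1"

lemma cell_bounds:
  assumes "0 < N" "0 < s" "s \<le> t"
  shows "t * real (cell N t s) / real N < s" "s \<le> t * (real (cell N t s) + 1) / real N"
    "cell N t s < N"
proof -
  have t: "0 < t" using assms by simp
  let ?x = "s * real N / t"
  have x: "0 < ?x" "?x \<le> real N" using assms t by (auto simp: field_simps)
  have c: "1 \<le> \<lceil>?x\<rceil>" using x(1) by linarith
  then have cell: "real (cell N t s) = of_int \<lceil>?x\<rceil> - 1"
    unfolding cell_def using nat_mono[OF c] by (subst of_nat_diff) auto
  have "real (cell N t s) < ?x" "?x \<le> real (cell N t s) + 1"
    unfolding cell by linarith+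
  then show "t * real (cell N t s) / real N < s" "s \<le> t * (real (cell N t s) + 1) / real N"
    using assms t by (auto simp: field_simps)
  show "cell N t s < N"
    using \<open>real (cell N t s) < ?x\<close> x(2) by linarith
qed

lemma cell_unique:
  assumes "0 < N" "0 < t" "t * real i / real N < s" "s \<le> t * (real i + 1) / real N"
  shows "cell N t s = i"
proof -
  have "\<lceil>s * real N / t\<rceil> = int i + 1"
    using assms by (intro ceiling_unique) (auto simp: field_simps)
  then show ?thesis unfolding cell_def by simp
qed

lemma cell_start_tendsto:
  assumes "0 < s" "s \<le> t"
  shows "(\<lambda>n. t * real (cell (Suc n) t s) / real (Suc n)) \<longlonglongrightarrow> s"
proof (rule tendsto_sandwich[of "\<lambda>n. s - t * (1 / real (Suc n))"])
  have "(\<lambda>n. s - t * (1 / real (Suc n))) \<longlonglongrightarrow> s - t * 0"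
    by (intro tendsto_intros LIMSEQ_Suc lim_1_over_n)
  then show "(\<lambda>n. s - t * (1 / real (Suc n))) \<longlonglongrightarrow> s" by simp
  show "\<forall>\<^sub>F n in sequentially. s - t * (1 / real (Suc n)) \<le> t * real (cell (Suc n) t s) / real (Suc n)"
  proof (intro always_eventually allI)
    fix n
    have "s \<le> t * (real (cell (Suc n) t s) + 1) / real (Suc n)"
      using assms by (intro cell_bounds) auto
    also have "\<dots> = t * real (cell (Suc n) t s) / real (Suc n) + t * (1 / real (Suc n))"
      by (simp only: distrib_left add_divide_distrib) simp
    finally show "s - t * (1 / real (Suc n)) \<le> t * real (cell (Suc n) t s) / real (Suc n)" by linarith
  qed
  show "\<forall>\<^sub>F n in sequentially. t * real (cell (Suc n) t s) / real (Suc n) \<le> s"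
    using assms cell_bounds(1)[of "Suc _" s t] by (intro always_eventually allI less_imp_le) blast
qed simp

section \<open>The probability that the process is alive\<close>

locale branching_immigration =
  fixes M :: "'a measure" and \<mu> :: real and p h :: "nat pmf" and r :: "real \<Rightarrow> real"
    and S :: "nat \<Rightarrow> 'a \<Rightarrow> real" and I :: "nat \<Rightarrow> 'a \<Rightarrow> nat"
    and Z :: "nat \<Rightarrow> nat \<Rightarrow> real \<Rightarrow> 'a \<Rightarrow> nat"
  assumes model: "branching_immigration_model M \<mu> p h r S I Z"
    and critical: "mean_one p"
begin

sublocale prob_space M
  using model by (simp add: branching_immigration_model_def)

lemma mu_pos: "0 < \<mu>"
  and poisson: "nonhom_poisson_process M r S"
  and group_size: "1 \<le> k \<Longrightarrow> I k \<in> measurable M (count_space UNIV)"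
    "1 \<le> k \<Longrightarrow> distr M (count_space UNIV) (I k) = measure_pmf h"
  and descent: "1 \<le> k \<Longrightarrow> 1 \<le> j \<Longrightarrow> markov_branching_process M \<mu> p (Z k j)"
  and independent_sources: "indep_sets (source_sigma M S I Z)
    ({Jumps} \<union> {Group_size k | k. 1 \<le> k} \<union> {Descent k j | k j. 1 \<le> k \<and> 1 \<le> j})"
  using model by (auto simp: branching_immigration_model_def)

lemma r_nonneg: "0 < t \<Longrightarrow> 0 \<le> r t"
  and r_integrable: "0 \<le> t \<Longrightarrow> set_integrable lborel {0..t} r"
  and S_measurable [measurable]: "S k \<in> borel_measurable M"
  and S_0: "\<omega> \<in> space M \<Longrightarrow> S 0 \<omega> = 0"
  and S_strict_mono: "\<omega> \<in> space M \<Longrightarrow> strict_mono (\<lambda>k. S k \<omega>)"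
  and S_finite: "\<omega> \<in> space M \<Longrightarrow> finite {k. S k \<omega> \<le> t}"
  and increments_indep: "0 \<le> \<tau> 0 \<Longrightarrow> mono \<tau> \<Longrightarrow> indep_vars (\<lambda>_. count_space UNIV)
      (\<lambda>i \<omega>. jump_count S (\<tau> (Suc i)) \<omega> - jump_count S (\<tau> i) \<omega>) UNIV"
  and increments_law: "0 \<le> s \<Longrightarrow> s \<le> t \<Longrightarrow>
        prob {\<omega>\<in>space M. jump_count S t \<omega> - jump_count S s \<omega> = n} =
          exp (- (mean_measure r t - mean_measure r s)) *
          (mean_measure r t - mean_measure r s) ^ n / fact n"
  using poisson by (auto simp: nonhom_poisson_process_def)

lemma S_pos:
  assumes "\<omega> \<in> space M" "1 \<le> k" shows "0 < S k \<omega>"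
  using strict_monoD[OF S_strict_mono[OF assms(1)], of 0 k] assms S_0 by simp

text \<open>The jump points increase, so those up to time \<open>t\<close> are exactly the first \<open>jump_count S t\<close> ones.\<close>

lemma le_jump_count_iff:
  assumes \<omega>: "\<omega> \<in> space M" and k: "1 \<le> k"
  shows "k \<le> jump_count S t \<omega> \<longleftrightarrow> S k \<omega> \<le> t"
proof -
  let ?A = "{k. 1 \<le> k \<and> S k \<omega> \<le> t}"
  have fin: "finite ?A" using S_finite[OF \<omega>, of t] by (rule rev_finite_subset) auto
  have mono: "S i \<omega> \<le> S j \<omega>" if "i \<le> j" for i j
    using strict_mono_mono[OF S_strict_mono[OF \<omega>]] that by (rule monoD)
  show ?thesis
  proof
    assume "S k \<omega> \<le> t"
    then have "{1..k} \<subseteq> ?A" by (auto intro: order_trans[OF mono])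
    from card_mono[OF fin this] show "k \<le> jump_count S t \<omega>" by (simp add: jump_count_def)
  next
    assume le: "k \<le> jump_count S t \<omega>"
    show "S k \<omega> \<le> t"
    proof (rule ccontr)
      assume "\<not> S k \<omega> \<le> t"
      then have "?A \<subseteq> {1..<k}" using mono by (force simp: not_le[symmetric] intro: order_trans)
      from card_mono[OF _ this] k le show False by (simp add: jump_count_def)
    qed
  qed
qed

lemma mean_measure_diff:
  assumes "0 \<le> s" "s \<le> t"
  shows "mean_measure r t - mean_measure r s = (LINT u:{s<..t}|lborel. r u)"
    and "0 \<le> mean_measure r t - mean_measure r s"
proof -
  have int: "set_integrable lborel {0..s} r" "set_integrable lborel {s<..t} r"
    using assms by (auto intro: set_integrable_subset[OF r_integrable[of t]])
  have "{0..t} = {0..s} \<union> {s<..t}" using assms by auto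
  then have "mean_measure r t = mean_measure r s + (LINT u:{s<..t}|lborel. r u)"
    unfolding mean_measure_def using int by (simp, subst set_integral_Un) auto
  then show eq: "mean_measure r t - mean_measure r s = (LINT u:{s<..t}|lborel. r u)"
    by simp
  show "0 \<le> mean_measure r t - mean_measure r s"
    unfolding eq set_lebesgue_integral_def using assms r_nonneg
    by (intro Bochner_Integration.integral_nonneg) (auto simp: indicator_def)
qed

lemma source_sigma_subset: "source_sigma M S I Z x \<subseteq> Pow (space M)"
proof (cases x)
  case Jumps
  then show ?thesis by (auto dest!: sigma_sets_into_sp[rotated])
next
  case (Group_size k)
  then show ?thesis by (auto dest!: sigma_sets_into_sp[rotated])
next
  case (Descent k j)
  then show ?thesis by (auto dest!: sigma_sets_into_sp[rotated])
qed

lemma Int_stable_source_sigma: "Int_stable (source_sigma M S I Z x)"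
proof -
  have *: "Int_stable (sigma_sets (space M) A)" if "A \<subseteq> Pow (space M)" for A
  proof -
    interpret sigma_algebra "space M" "sigma_sets (space M) A"
      using that by (rule sigma_algebra_sigma_sets)
    show ?thesis by (auto simp: Int_stable_def)
  qed
  show ?thesis by (cases x) (auto intro!: *)
qed

lemma source_sigma_events:
  "1 \<le> k \<Longrightarrow> {\<omega>\<in>space M. I k \<omega> = n} \<in> source_sigma M S I Z (Group_size k)"
  "0 \<le> t \<Longrightarrow> {\<omega>\<in>space M. Z k j t \<omega> = m} \<in> source_sigma M S I Z (Descent k j)"
proof -
  show "{\<omega>\<in>space M. I k \<omega> = n} \<in> source_sigma M S I Z (Group_size k)"
    by (auto intro!: sigma_sets.Basic exI[of _ "{n}"])
  show "{\<omega>\<in>space M. Z k j t \<omega> = m} \<in> source_sigma M S I Z (Descent k j)" if "0 \<le> t"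
    using that by (auto intro!: sigma_sets.Basic exI[of _ "{m}"] exI[of _ t])
qed

lemma descent_event:
  assumes "1 \<le> k" "1 \<le> j" "0 \<le> t"
  shows "{\<omega>\<in>space M. Z k j t \<omega> = n} \<in> sets M"
  using source_sigma_events(2)[of t k j n] independent_sources assms
  unfolding indep_sets_def by blast

definition ext_prob :: "real \<Rightarrow> real" where
  "ext_prob t = prob {\<omega>\<in>space M. Z 1 1 t \<omega> = 0}"

text \<open>The probability that a group of immigrants has living descendants \<open>t\<close> units of time after its arrival.\<close>

definition surv :: "real \<Rightarrow> real" where
  "surv t = 1 - pgf h (ext_prob t)"

lemma ext_prob_eq: "1 \<le> k \<Longrightarrow> 1 \<le> j \<Longrightarrow> 0 \<le> t \<Longrightarrow> prob {\<omega>\<in>space M. Z k j t \<omega> = 0} = ext_prob t"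
  unfolding ext_prob_def
  by (rule extinction_probability_unique[OF prob_space_axioms descent descent]) auto

lemma ext_prob_bounds: "0 \<le> ext_prob t" "ext_prob t \<le> 1"
  by (auto simp: ext_prob_def)

lemma surv_bounds: "0 \<le> surv t" "surv t \<le> 1"
  using pgf_bounds[OF ext_prob_bounds] by (auto simp: surv_def)

lemma surv_eq_q_fun: "0 \<le> t \<Longrightarrow> surv t = q_fun M h (Z 1 1) t 0"
proof -
  assume "0 \<le> t"
  then have "{\<omega>\<in>space M. Z 1 1 t \<omega> = 0} \<in> sets M" by (intro descent_event) auto
  then have "prob {\<omega>\<in>space M. Z 1 1 t \<omega> = 0} = (LINT \<omega>|M. indicator {\<omega>\<in>space M. Z 1 1 t \<omega> = 0} \<omega>)"
    by simp
  also have "\<dots> = (LINT \<omega>|M. 0 ^ Z 1 1 t \<omega>)"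
    by (rule Bochner_Integration.integral_cong) (auto simp: indicator_def power_0_left)
  finally show ?thesis
    unfolding surv_def ext_prob_def q_fun_def branching_pgf_def by simp
qed

definition group_extinct :: "nat \<Rightarrow> real \<Rightarrow> 'a set" where
  "group_extinct k t = {\<omega>\<in>space M. \<forall>j\<in>{1..I k \<omega>}. Z k j t \<omega> = 0}"

text \<open>The sources are grouped into the jump times and, for each \<open>k\<close>, everything that concerns the \<open>k\<close>-th group.
  The groups of sources are again independent.\<close>

primrec cluster :: "nat option \<Rightarrow> source set" where
  "cluster None = {Jumps}"
| "cluster (Some k) = insert (Group_size k) {Descent k j | j. 1 \<le> j}"

definition cluster_sigma :: "nat option \<Rightarrow> 'a set set" where
  "cluster_sigma c = sigma_sets (space M) (\<Union>x\<in>cluster c. source_sigma M S I Z x)"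

lemma independent_clusters: "indep_sets cluster_sigma (insert None (Some ` {1..}))"
  unfolding cluster_sigma_def
proof (rule indep_sets_collect_sigma)
  have "(\<Union>c\<in>insert None (Some ` {1..}). cluster c) =
    {Jumps} \<union> {Group_size k | k. 1 \<le> k} \<union> {Descent k j | k j. 1 \<le> k \<and> 1 \<le> j}"
    by auto
  then show "indep_sets (source_sigma M S I Z) (\<Union>c\<in>insert None (Some ` {1..}). cluster c)"
    using independent_sources by simp
  show "disjoint_family_on cluster (insert None (Some ` {1..}))"
    by (auto simp: disjoint_family_on_def)
qed (rule Int_stable_source_sigma)

lemma group_extinct_cluster:
  assumes k: "1 \<le> k" and t: "0 \<le> t"
  shows "group_extinct k t \<in> cluster_sigma (Some k)"
proof -
  define G where "G = sigma (space M) (\<Union>x\<in>cluster (Some k). source_sigma M S I Z x)"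
  have sub: "(\<Union>x\<in>cluster (Some k). source_sigma M S I Z x) \<subseteq> Pow (space M)"
    using source_sigma_subset by blast
  have sets: "sets G = cluster_sigma (Some k)" and space: "space G = space M"
    unfolding G_def cluster_sigma_def using sub by auto
  have basic: "A \<in> sets G" if "A \<in> source_sigma M S I Z x" "x \<in> cluster (Some k)" for A x
    unfolding sets cluster_sigma_def using that by (intro sigma_sets.Basic) blast
  have [measurable]: "Measurable.pred G (\<lambda>\<omega>. I k \<omega> = n)" for n
    unfolding pred_def space using source_sigma_events(1)[OF k] by (rule basic) simp
  \<comment> \<open>Descendants are numbered from 1; nothing is known about the process with index 0.\<close>
  define Q where "Q j \<omega> \<longleftrightarrow> (1 \<le> j \<longrightarrow> Z k j t \<omega> = 0)" for j \<omega>
  have [measurable]: "Measurable.pred G (Q j)" for j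
  proof (cases "1 \<le> j")
    case True
    have "{\<omega>\<in>space M. Z k j t \<omega> = 0} \<in> sets G"
      using source_sigma_events(2)[OF t] by (rule basic) (use True in simp)
    with True show ?thesis by (simp add: Q_def pred_def space)
  next
    case False
    then have "Q j = (\<lambda>\<omega>. True)" by (auto simp: Q_def)
    then show ?thesis by simp
  qed
  have "Measurable.pred G (\<lambda>\<omega>. \<forall>n. I k \<omega> = n \<longrightarrow> (\<forall>j. j \<le> n \<longrightarrow> Q j \<omega>))"
    by measurable
  moreover have "group_extinct k t = {\<omega>\<in>space G. \<forall>n. I k \<omega> = n \<longrightarrow> (\<forall>j. j \<le> n \<longrightarrow> Q j \<omega>)}"
    unfolding group_extinct_def space Q_def by auto
  ultimately show ?thesis
    by (simp add: pred_def sets)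
qed

lemma group_extinct_event: "1 \<le> k \<Longrightarrow> 0 \<le> t \<Longrightarrow> group_extinct k t \<in> sets M"
  using group_extinct_cluster[of k t] independent_clusters unfolding indep_sets_def by auto

text \<open>Given that the group has size \<open>n\<close>, its members die out independently, which gives \<open>ext_prob t ^ n\<close>; averaging
  over \<open>n\<close> produces the generating function of the group size.\<close>

lemma prob_group_extinct:
  assumes k: "1 \<le> k" and t: "0 \<le> t"
  shows "prob (group_extinct k t) = 1 - surv t"
proof -
  define A where "A n = space M \<inter> (\<Inter>j\<in>{1..n}. {\<omega>\<in>space M. Z k j t \<omega> = 0})" for n :: nat
  have A: "A n \<in> sets M" for n
  proof (cases "n = 0")
    case False
    then show ?thesis
      unfolding A_def using descent_event[OF k _ t] by (intro sets.Int sets.finite_INT) auto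
  qed (simp add: A_def)
  have "group_extinct k t = {\<omega>\<in>space M. \<omega> \<in> A (I k \<omega>)}"
    unfolding group_extinct_def A_def by auto
  also have "prob \<dots> = expectation (\<lambda>\<omega>. ext_prob t ^ I k \<omega>)"
  proof (rule prob_countable_decomposition[OF group_size(1)[OF k] A])
    fix n :: nat
    show "0 \<le> ext_prob t ^ n" "ext_prob t ^ n \<le> 1" using ext_prob_bounds by (auto simp: power_le_one)
    define E where "E x = (case x of Group_size _ \<Rightarrow> {\<omega>\<in>space M. I k \<omega> = n}
      | Descent _ j \<Rightarrow> {\<omega>\<in>space M. Z k j t \<omega> = 0} | Jumps \<Rightarrow> {})" for x
    let ?J = "insert (Group_size k) (Descent k ` {1..n})"
    have "prob (\<Inter>x\<in>?J. E x) = (\<Prod>x\<in>?J. prob (E x))"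
      using source_sigma_events(1)[OF k] source_sigma_events(2)[OF t] k
      by (intro indep_setsD[OF independent_sources]) (auto simp: E_def simp del: source_sigma.simps)
    also have "(\<Inter>x\<in>?J. E x) = {\<omega>\<in>space M. I k \<omega> = n} \<inter> A n"
      by (auto simp: E_def A_def)
    also have "(\<Prod>x\<in>?J. prob (E x)) = prob {\<omega>\<in>space M. I k \<omega> = n} * (\<Prod>j=1..n. prob {\<omega>\<in>space M. Z k j t \<omega> = 0})"
      by (subst prod.insert) (auto simp: E_def prod.reindex inj_on_def)
    also have "(\<Prod>j=1..n. prob {\<omega>\<in>space M. Z k j t \<omega> = 0}) = ext_prob t ^ n"
      using ext_prob_eq[OF k _ t] by simp
    finally show "prob ({\<omega>\<in>space M. I k \<omega> = n} \<inter> A n) = prob {\<omega>\<in>space M. I k \<omega> = n} * ext_prob t ^ n" .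
  qed
  also have "\<dots> = (LINT n|distr M (count_space UNIV) (I k). ext_prob t ^ n)"
    using group_size(1)[OF k] by (subst integral_distr) auto
  also have "\<dots> = 1 - surv t"
    by (simp add: group_size(2)[OF k] pgf_def surv_def)
  finally show ?thesis .
qed

lemma Y_eq_0_iff:
  "Y_process S I Z t \<omega> = 0 \<longleftrightarrow>
    (\<forall>k\<in>{1..jump_count S t \<omega>}. \<forall>j\<in>{1..I k \<omega>}. Z k j (t - S k \<omega>) \<omega> = 0)"
  by (simp add: Y_process_def)

lemma descent_event_random_time:
  assumes "1 \<le> k" "1 \<le> j" and [measurable]: "\<tau> \<in> borel_measurable M"
    and nonneg: "\<And>\<omega>. \<omega> \<in> space M \<Longrightarrow> 0 \<le> \<tau> \<omega>"
  shows "Measurable.pred M (\<lambda>\<omega>. Z k j (\<tau> \<omega>) \<omega> = 0)"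
proof -
  obtain T X where T: "\<And>u. distributed M lborel (T u) (exponential_density \<mu>)"
    and X[measurable]: "\<And>u. X u \<in> measurable M (count_space UNIV)"
    and card: "\<And>t \<omega>. 0 \<le> t \<Longrightarrow> \<omega> \<in> space M \<Longrightarrow> Z k j t \<omega> = card (alive_at T X t \<omega>)"
    using descent[OF assms(1,2)] unfolding markov_branching_process_def by blast
  have [measurable]: "T u \<in> borel_measurable M" for u
    using T[of u] by (simp add: distributed_def)
  have "Measurable.pred M (\<lambda>\<omega>. card (alive_at T X (\<tau> \<omega>) \<omega>) = 0)"
    by (rule pred_no_alive) measurable
  then show ?thesis
    by (rule measurable_cong[THEN iffD1, rotated]) (simp add: card nonneg)
qed

lemma Y_event: "{\<omega>\<in>space M. Y_process S I Z t \<omega> = 0} \<in> sets M"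
proof -
  \<comment> \<open>The maximum keeps the time nonnegative; it changes nothing for the groups that have arrived.\<close>
  define Q where "Q k j \<omega> \<longleftrightarrow> (1 \<le> k \<longrightarrow> 1 \<le> j \<longrightarrow> Z k j (max 0 (t - S k \<omega>)) \<omega> = 0)" for k j \<omega>
  have [measurable]: "Measurable.pred M (Q k j)" for k j
  proof (cases "1 \<le> k \<and> 1 \<le> j")
    case True
    then have "Measurable.pred M (\<lambda>\<omega>. Z k j (max 0 (t - S k \<omega>)) \<omega> = 0)"
      by (intro descent_event_random_time) auto
    moreover have "Q k j = (\<lambda>\<omega>. Z k j (max 0 (t - S k \<omega>)) \<omega> = 0)"
      using True by (auto simp: Q_def)
    ultimately show ?thesis by simp
  next
    case False
    then have "Q k j = (\<lambda>\<omega>. True)" by (auto simp: Q_def)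
    then show ?thesis by simp
  qed
  define R where "R k \<omega> \<longleftrightarrow> (1 \<le> k \<longrightarrow> (\<forall>j. j \<le> I k \<omega> \<longrightarrow> Q k j \<omega>))" for k \<omega>
  have [measurable]: "Measurable.pred M (R k)" for k
  proof (cases "1 \<le> k")
    case True
    note group_size(1)[OF True, measurable]
    have "Measurable.pred M (\<lambda>\<omega>. \<forall>j. j \<le> I k \<omega> \<longrightarrow> Q k j \<omega>)" by measurable
    moreover have "R k = (\<lambda>\<omega>. \<forall>j. j \<le> I k \<omega> \<longrightarrow> Q k j \<omega>)"
      using True by (auto simp: R_def)
    ultimately show ?thesis by simp
  next
    case False
    then have "R k = (\<lambda>\<omega>. True)" by (auto simp: R_def)
    then show ?thesis by simp
  qed
  have "{\<omega>\<in>space M. \<forall>k. S k \<omega> \<le> t \<longrightarrow> R k \<omega>} \<in> sets M"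
    by measurable
  also have "{\<omega>\<in>space M. \<forall>k. S k \<omega> \<le> t \<longrightarrow> R k \<omega>} = {\<omega>\<in>space M. Y_process S I Z t \<omega> = 0}"
  proof (intro Collect_cong conj_cong refl)
    fix \<omega> assume \<omega>: "\<omega> \<in> space M"
    show "(\<forall>k. S k \<omega> \<le> t \<longrightarrow> R k \<omega>) \<longleftrightarrow> Y_process S I Z t \<omega> = 0"
      unfolding Y_eq_0_iff R_def Q_def using le_jump_count_iff[OF \<omega>, of _ t] by auto
  qed
  finally show ?thesis .
qed

text \<open>These events, one for each list \<open>d\<close> of cells, partition the space. They will be conditioned on, and they are
  independent of the immigrant groups because the jump times alone determine them.\<close>

lemma jump_count_event:
  "{\<omega>\<in>space M. jump_count S t \<omega> = length d \<and> (\<forall>k\<in>{1..length d}. c (S k \<omega>) = d ! (k - 1))}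
    \<in> cluster_sigma None"
  if [measurable]: "c \<in> measurable borel (count_space UNIV)" for c :: "real \<Rightarrow> nat"
proof -
  define G where "G = sigma (space M) {S k -` B \<inter> space M | k B. B \<in> sets borel}"
  have sets: "sets G = cluster_sigma None" and space: "space G = space M"
  proof -
    have "sigma_sets (space M) (sigma_sets (space M) {S k -` B \<inter> space M | k B. B \<in> sets borel}) =
       sigma_sets (space M) {S k -` B \<inter> space M | k B. B \<in> sets borel}"
      by (rule sigma_sets_sigma_sets_eq) auto
    then show "sets G = cluster_sigma None"
      unfolding G_def cluster_sigma_def by (simp add: sets_measure_of_conv) auto
    show "space G = space M" unfolding G_def by (rule space_measure_of) auto
  qed
  have [measurable]: "S k \<in> borel_measurable G" for k
  proof (rule measurableI)
    fix B :: "real set" assume "B \<in> sets borel"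
    then show "S k -` B \<inter> space G \<in> sets G"
      unfolding space by (auto simp: G_def intro!: sigma_sets.Basic)
  qed simp
  have "{\<omega>\<in>space M. jump_count S t \<omega> = length d \<and> (\<forall>k\<in>{1..length d}. c (S k \<omega>) = d ! (k - 1))} =
    {\<omega>\<in>space G. (\<forall>k. 1 \<le> k \<longrightarrow> (k \<le> length d \<longleftrightarrow> S k \<omega> \<le> t)) \<and> (\<forall>k\<in>{1..length d}. c (S k \<omega>) = d ! (k - 1))}"
  proof -
    have "jump_count S t \<omega> = n \<longleftrightarrow> (\<forall>k\<ge>1. (k \<le> n \<longleftrightarrow> S k \<omega> \<le> t))" if "\<omega> \<in> space M" for \<omega> n
    proof -
      have "jump_count S t \<omega> = n \<longleftrightarrow> (\<forall>k\<ge>1. (k \<le> n \<longleftrightarrow> k \<le> jump_count S t \<omega>))"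
        by (metis Suc_eq_plus1 le_add2 le_antisym nle_le not_less_eq_eq le0)
      then show ?thesis using le_jump_count_iff[OF that] by simp
    qed
    then show ?thesis by (auto simp: space)
  qed
  also have "\<dots> \<in> sets G" by measurable
  finally show ?thesis by (simp add: sets)
qed

text \<open>The \<open>k\<close>-th group is examined at an age \<open>a (c (S k \<omega>))\<close> that takes countably many values, so one can condition
  on the list of all cells that contain jump points. Given this list the groups are independent.\<close>

lemma prob_all_groups_extinct:
  assumes a: "\<And>i. 0 \<le> a i" and c[measurable]: "c \<in> measurable borel (count_space UNIV)"
  shows "prob {\<omega>\<in>space M. \<forall>k\<in>{1..jump_count S t \<omega>}. \<omega> \<in> group_extinct k (a (c (S k \<omega>) :: nat))} =
    expectation (\<lambda>\<omega>. \<Prod>k=1..jump_count S t \<omega>. 1 - surv (a (c (S k \<omega>))))"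
    and "{\<omega>\<in>space M. \<forall>k\<in>{1..jump_count S t \<omega>}. \<omega> \<in> group_extinct k (a (c (S k \<omega>) :: nat))} \<in> sets M"
proof -
  define K where "K \<omega> = map (\<lambda>k. c (S k \<omega>)) [1..<Suc (jump_count S t \<omega>)]" for \<omega>
  define A where "A d = space M \<inter> (\<Inter>k\<in>{1..length d}. group_extinct k (a (d ! (k - 1))))" for d
  define \<phi> where "\<phi> d = (\<Prod>k=1..length d. 1 - surv (a (d ! (k - 1))))" for d
  have K_nth: "K \<omega> ! (k - 1) = c (S k \<omega>)" if "k \<in> {1..jump_count S t \<omega>}" for k \<omega>
  proof -
    from that have "k - 1 < jump_count S t \<omega>" "Suc (k - 1) = k" by auto
    then show ?thesis by (simp add: K_def nth_upt del: upt_Suc)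
  qed
  have K_len: "length (K \<omega>) = jump_count S t \<omega>" for \<omega>
    by (simp add: K_def)
  have K_eq: "K \<omega> = d \<longleftrightarrow>
      jump_count S t \<omega> = length d \<and> (\<forall>k\<in>{1..length d}. c (S k \<omega>) = d ! (k - 1))" for \<omega> d
  proof
    assume *: "jump_count S t \<omega> = length d \<and> (\<forall>k\<in>{1..length d}. c (S k \<omega>) = d ! (k - 1))"
    show "K \<omega> = d"
    proof (rule nth_equalityI)
      fix i assume "i < length (K \<omega>)"
      then have "Suc i \<in> {1..jump_count S t \<omega>}" by (simp add: K_len)
      from K_nth[OF this] this * show "K \<omega> ! i = d ! i" by auto
    qed (use * K_len in auto)
  qed (use K_len K_nth in auto)
  have K_cluster: "{\<omega>\<in>space M. K \<omega> = d} \<in> cluster_sigma None" for d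
    unfolding K_eq by (rule jump_count_event) (rule c)
  then have K_event: "{\<omega>\<in>space M. K \<omega> = d} \<in> sets M" for d
    using independent_clusters unfolding indep_sets_def by blast
  have K: "K \<in> measurable M (count_space UNIV)"
  proof (subst measurable_count_space_eq2_countable)
    have "K -` {d} \<inter> space M = {\<omega>\<in>space M. K \<omega> = d}" for d by auto
    then show "K \<in> space M \<rightarrow> UNIV \<and> (\<forall>d\<in>UNIV. K -` {d} \<inter> space M \<in> sets M)"
      using K_event by auto
  qed
  have A: "A d \<in> sets M" for d
  proof (cases "d = []")
    case False
    then show ?thesis
      unfolding A_def by (intro sets.Int sets.finite_INT) (auto simp: Suc_le_eq intro!: group_extinct_event a)
  qed (simp add: A_def)
  have set_eq: "{\<omega>\<in>space M. \<forall>k\<in>{1..jump_count S t \<omega>}. \<omega> \<in> group_extinct k (a (c (S k \<omega>)))} =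
      {\<omega>\<in>space M. \<omega> \<in> A (K \<omega>)}"
    unfolding A_def using K_nth by (auto simp: K_len)
  show "{\<omega>\<in>space M. \<forall>k\<in>{1..jump_count S t \<omega>}. \<omega> \<in> group_extinct k (a (c (S k \<omega>) :: nat))} \<in> sets M"
    unfolding set_eq by (rule sets_countable_choice[OF K A])
  have "prob {\<omega>\<in>space M. \<forall>k\<in>{1..jump_count S t \<omega>}. \<omega> \<in> group_extinct k (a (c (S k \<omega>)))} =
      prob {\<omega>\<in>space M. \<omega> \<in> A (K \<omega>)}"
    by (simp only: set_eq)
  also have "\<dots> = expectation (\<lambda>\<omega>. \<phi> (K \<omega>))"
  proof (rule prob_countable_decomposition[OF K A])
    fix d
    show "0 \<le> \<phi> d" "\<phi> d \<le> 1"
      unfolding \<phi>_def using surv_bounds by (auto intro!: prod_nonneg prod_le_1)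
    define E where "E x = (case x of None \<Rightarrow> {\<omega>\<in>space M. K \<omega> = d}
      | Some k \<Rightarrow> group_extinct k (a (d ! (k - 1))))" for x
    let ?J = "insert None (Some ` {1..length d})"
    have "prob (\<Inter>x\<in>?J. E x) = (\<Prod>x\<in>?J. prob (E x))"
      using K_cluster group_extinct_cluster a
      by (intro indep_setsD[OF independent_clusters]) (auto simp: E_def)
    also have "(\<Inter>x\<in>?J. E x) = {\<omega>\<in>space M. K \<omega> = d} \<inter> A d"
      by (auto simp: E_def A_def)
    also have "(\<Prod>x\<in>?J. prob (E x)) = prob {\<omega>\<in>space M. K \<omega> = d} * \<phi> d"
      using a by (subst prod.insert) (auto simp: E_def prod.reindex \<phi>_def prob_group_extinct)
    finally show "prob ({\<omega>\<in>space M. K \<omega> = d} \<inter> A d) = prob {\<omega>\<in>space M. K \<omega> = d} * \<phi> d" .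
  qed
  also have "(\<lambda>\<omega>. \<phi> (K \<omega>)) = (\<lambda>\<omega>. \<Prod>k=1..jump_count S t \<omega>. 1 - surv (a (c (S k \<omega>))))"
    unfolding \<phi>_def K_len using K_nth by (intro ext prod.cong) auto
  finally show "prob {\<omega>\<in>space M. \<forall>k\<in>{1..jump_count S t \<omega>}. \<omega> \<in> group_extinct k (a (c (S k \<omega>) :: nat))} =
    expectation (\<lambda>\<omega>. \<Prod>k=1..jump_count S t \<omega>. 1 - surv (a (c (S k \<omega>))))" .
qed

text \<open>Factors belonging to jumps in the same cell agree, and the number of such jumps is an increment
  of the counting process.\<close>

lemma prod_jumps_by_cell:
  assumes \<omega>: "\<omega> \<in> space M" and "0 < N" "0 < t"
  shows "(\<Prod>k=1..jump_count S t \<omega>. v (cell N t (S k \<omega>))) =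
    (\<Prod>i<N. v i ^ (jump_count S (t * real (Suc i) / real N) \<omega> - jump_count S (t * real i / real N) \<omega>))"
proof -
  have S: "0 < S k \<omega>" "S k \<omega> \<le> t" if "k \<in> {1..jump_count S t \<omega>}" for k
    using that S_pos[OF \<omega>] le_jump_count_iff[OF \<omega>] by auto
  have "(\<Prod>k=1..jump_count S t \<omega>. v (cell N t (S k \<omega>))) =
      (\<Prod>i<N. \<Prod>k\<in>{k\<in>{1..jump_count S t \<omega>}. cell N t (S k \<omega>) = i}. v (cell N t (S k \<omega>)))"
    using S cell_bounds(3)[OF \<open>0 < N\<close>] by (intro prod.group[symmetric]) auto
  also have "\<dots> = (\<Prod>i<N. v i ^ (jump_count S (t * real (Suc i) / real N) \<omega> - jump_count S (t * real i / real N) \<omega>))"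
  proof (rule prod.cong)
    fix i assume i: "i \<in> {..<N}"
    let ?lo = "jump_count S (t * real i / real N) \<omega>" and ?hi = "jump_count S (t * real (Suc i) / real N) \<omega>"
    have "{k\<in>{1..jump_count S t \<omega>}. cell N t (S k \<omega>) = i} = {1..?hi} - {1..?lo}"
    proof (intro set_eqI iffI)
      fix k assume k: "k \<in> {k\<in>{1..jump_count S t \<omega>}. cell N t (S k \<omega>) = i}"
      then show "k \<in> {1..?hi} - {1..?lo}"
        using cell_bounds(1,2)[OF \<open>0 < N\<close> S[of k]] by (auto simp: le_jump_count_iff[OF \<omega>] add_ac)
    next
      fix k assume k: "k \<in> {1..?hi} - {1..?lo}"
      then have *: "1 \<le> k" "t * real i / real N < S k \<omega>" "S k \<omega> \<le> t * (real i + 1) / real N"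
        by (auto simp: le_jump_count_iff[OF \<omega>] add_ac)
      have "t * (real i + 1) / real N \<le> t * real N / real N"
        using i assms by (intro divide_right_mono mult_left_mono) auto
      with * assms have "S k \<omega> \<le> t" by simp
      with * show "k \<in> {k\<in>{1..jump_count S t \<omega>}. cell N t (S k \<omega>) = i}"
        using cell_unique[OF \<open>0 < N\<close> \<open>0 < t\<close> *(2,3)] by (auto simp: le_jump_count_iff[OF \<omega>])
    qed
    moreover have "?lo \<le> ?hi"
    proof (cases "?lo = 0")
      case False
      have "t * real i / real N \<le> t * real (Suc i) / real N"
        using assms by (intro divide_right_mono mult_left_mono) auto
      moreover have "S ?lo \<omega> \<le> t * real i / real N"
        using le_jump_count_iff[OF \<omega>, of ?lo "t * real i / real N"] False by simp
      ultimately have "S ?lo \<omega> \<le> t * real (Suc i) / real N" by simp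
      then show ?thesis
        using le_jump_count_iff[OF \<omega>, of ?lo "t * real (Suc i) / real N"] False by simp
    qed simp
    ultimately have card: "card {k\<in>{1..jump_count S t \<omega>}. cell N t (S k \<omega>) = i} = ?hi - ?lo"
      by (subst \<open>_ = {1..?hi} - {1..?lo}\<close>, subst card_Diff_subset) auto
    have "(\<Prod>k\<in>{k\<in>{1..jump_count S t \<omega>}. cell N t (S k \<omega>) = i}. v (cell N t (S k \<omega>))) =
      (\<Prod>k\<in>{k\<in>{1..jump_count S t \<omega>}. cell N t (S k \<omega>) = i}. v i)"
      by (intro prod.cong) auto
    then show "(\<Prod>k\<in>{k\<in>{1..jump_count S t \<omega>}. cell N t (S k \<omega>) = i}. v (cell N t (S k \<omega>))) = v i ^ (?hi - ?lo)"
      by (simp only: prod_constant card)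
  qed simp
  finally show ?thesis .
qed

text \<open>The exponential formula for functionals that depend on the cells only: the increments over different cells
  are independent Poisson variables, and each contributes its generating function.\<close>

lemma expectation_prod_jumps:
  assumes "0 < N" "0 < t" and v: "\<And>i. 0 \<le> v i" "\<And>i. v i \<le> 1"
  shows "expectation (\<lambda>\<omega>. \<Prod>k=1..jump_count S t \<omega>. v (cell N t (S k \<omega>))) =
    exp (- (LINT u:{0<..t}|lborel. r u * (1 - v (cell N t u))))"
proof -
  define \<tau> where "\<tau> i = t * real i / real N" for i
  have \<tau>_mono: "mono \<tau>"
    unfolding \<tau>_def using assms by (intro monoI divide_right_mono mult_left_mono) auto
  have \<tau>_le: "\<tau> i \<le> \<tau> (Suc i)" for i
    using \<tau>_mono by (rule monoD) simp
  have \<tau>_nonneg: "0 \<le> \<tau> i" for i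
    using assms by (simp add: \<tau>_def)
  have \<tau>_le_t: "\<tau> (Suc i) \<le> t" if "i < N" for i
  proof -
    have "\<tau> (Suc i) \<le> t * real N / real N"
      unfolding \<tau>_def using that assms by (intro divide_right_mono mult_left_mono) auto
    then show ?thesis using assms by simp
  qed
  define D where "D i \<omega> = jump_count S (\<tau> (Suc i)) \<omega> - jump_count S (\<tau> i) \<omega>" for i \<omega>
  define m where "m i = mean_measure r (\<tau> (Suc i)) - mean_measure r (\<tau> i)" for i
  have ind: "indep_vars (\<lambda>_. count_space UNIV) D UNIV"
    unfolding D_def using increments_indep[of \<tau>] \<tau>_mono \<tau>_nonneg by blast
  then have D_meas: "D i \<in> measurable M (count_space UNIV)" for i
    by (auto simp: indep_vars_def)
  have "indep_vars (\<lambda>_. borel) (\<lambda>i \<omega>. (\<lambda>i n. v i ^ n) i (D i \<omega>)) {..<N}"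
    by (rule indep_vars_compose2[OF indep_vars_subset[OF ind]]) auto
  then have ind': "indep_vars (\<lambda>_. borel) (\<lambda>i \<omega>. v i ^ D i \<omega>) {..<N}"
    by simp
  have "expectation (\<lambda>\<omega>. \<Prod>k=1..jump_count S t \<omega>. v (cell N t (S k \<omega>))) = expectation (\<lambda>\<omega>. \<Prod>i<N. v i ^ D i \<omega>)"
    using prod_jumps_by_cell[of _ N t v] assms
    by (intro Bochner_Integration.integral_cong) (auto simp: D_def \<tau>_def)
  also have "\<dots> = (\<Prod>i<N. expectation (\<lambda>\<omega>. v i ^ D i \<omega>))"
  proof (rule indep_vars_lebesgue_integral[OF _ ind'])
    fix i
    show "integrable M (\<lambda>\<omega>. v i ^ D i \<omega>)"
      using v D_meas[of i] by (intro integrable_const_bound[of _ 1]) (auto simp: power_le_one)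
  qed simp
  also have "\<dots> = (\<Prod>i<N. exp (- m i * (1 - v i)))"
  proof (intro prod.cong refl expectation_power_poisson D_meas v)
    fix i
    show "0 \<le> m i" unfolding m_def using \<tau>_nonneg \<tau>_le by (intro mean_measure_diff)
    show "prob {\<omega>\<in>space M. D i \<omega> = n} = exp (- m i) * m i ^ n / fact n" for n
      unfolding D_def m_def using \<tau>_nonneg \<tau>_le by (intro increments_law)
  qed
  also have "\<dots> = exp (- (\<Sum>i<N. m i * (1 - v i)))"
    by (simp add: exp_sum sum_negf[symmetric])
  also have "(\<Sum>i<N. m i * (1 - v i)) = (\<Sum>i<N. LINT u:{\<tau> i<..\<tau> (Suc i)}|lborel. r u * (1 - v (cell N t u)))"
  proof (rule sum.cong)
    fix i
    have "(LINT u:{\<tau> i<..\<tau> (Suc i)}|lborel. r u * (1 - v (cell N t u))) =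
        (LINT u:{\<tau> i<..\<tau> (Suc i)}|lborel. r u * (1 - v i))"
    proof (rule set_lebesgue_integral_cong)
      show "\<forall>u. u \<in> {\<tau> i<..\<tau> (Suc i)} \<longrightarrow> r u * (1 - v (cell N t u)) = r u * (1 - v i)"
        using cell_unique[OF assms(1,2), of i] by (auto simp: \<tau>_def add_ac)
    qed simp
    also have "\<dots> = m i * (1 - v i)"
      using mean_measure_diff(1)[OF \<tau>_nonneg \<tau>_le, of i] by (simp add: m_def)
    finally show "m i * (1 - v i) = (LINT u:{\<tau> i<..\<tau> (Suc i)}|lborel. r u * (1 - v (cell N t u)))" ..
  qed simp
  also have "\<dots> = (LINT u:(\<Union>i\<in>{..<N}. {\<tau> i<..\<tau> (Suc i)})|lborel. r u * (1 - v (cell N t u)))"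
  proof (rule set_integral_finite_Union[symmetric])
    show "disjoint_family_on (\<lambda>i. {\<tau> i<..\<tau> (Suc i)}) {..<N}"
      using cell_unique[OF assms(1,2)] unfolding disjoint_family_on_def \<tau>_def
      by (auto simp: add_ac set_eq_iff)
    fix i assume "i \<in> {..<N}"
    then have "\<tau> (Suc i) \<le> t" by (simp add: \<tau>_le_t)
    then have "set_integrable lborel {\<tau> i<..\<tau> (Suc i)} r"
      using \<tau>_nonneg[of i] assms by (intro set_integrable_subset[OF r_integrable[of t]]) auto
    then have "set_integrable lborel {\<tau> i<..\<tau> (Suc i)} (\<lambda>u. r u * (1 - v i))"
      by simp
    moreover have "set_integrable lborel {\<tau> i<..\<tau> (Suc i)} (\<lambda>u. r u * (1 - v i)) \<longleftrightarrow>
      set_integrable lborel {\<tau> i<..\<tau> (Suc i)} (\<lambda>u. r u * (1 - v (cell N t u)))"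
      using cell_unique[OF assms(1,2), of i] by (intro set_integrable_cong) (auto simp: \<tau>_def add_ac)
    ultimately show "set_integrable lborel {\<tau> i<..\<tau> (Suc i)} (\<lambda>u. r u * (1 - v (cell N t u)))"
      by simp
  qed auto
  also have "(\<Union>i\<in>{..<N}. {\<tau> i<..\<tau> (Suc i)}) = {0<..t}"
  proof (intro set_eqI iffI)
    fix u assume "u \<in> (\<Union>i\<in>{..<N}. {\<tau> i<..\<tau> (Suc i)})"
    then obtain i where i: "i < N" "\<tau> i < u" "u \<le> \<tau> (Suc i)" by auto
    have "\<tau> (Suc i) \<le> t" using i(1) by (rule \<tau>_le_t)
    with i \<tau>_nonneg[of i] show "u \<in> {0<..t}" by auto
  next
    fix u assume "u \<in> {0<..t}"
    then show "u \<in> (\<Union>i\<in>{..<N}. {\<tau> i<..\<tau> (Suc i)})"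
      using cell_bounds[OF \<open>0 < N\<close>, of u t]
      by (intro UN_I[of "cell N t u"]) (auto simp: \<tau>_def add_ac)
  qed
  finally show ?thesis .
qed

lemma ext_prob_tendsto:
  assumes s: "0 \<le> s" and X: "\<And>n. s < X n" "X \<longlonglongrightarrow> s"
  shows "(\<lambda>n. ext_prob (X n)) \<longlonglongrightarrow> ext_prob s"
proof -
  define E where "E s = {\<omega>\<in>space M. Z 1 1 s \<omega> = 0}" for s
  have E[measurable]: "E s \<in> sets M" if "0 \<le> s" for s
    unfolding E_def using that by (intro descent_event) auto
  have X0: "0 \<le> X n" for n using X(1)[of n] s by simp
  have "filterlim X (at_right s) sequentially"
    unfolding filterlim_at using X by (auto intro!: always_eventually)
  have "(\<lambda>n. LINT \<omega>|M. indicat_real (E (X n)) \<omega>) \<longlonglongrightarrow> (LINT \<omega>|M. indicat_real (E s) \<omega>)"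
  proof (rule integral_dominated_convergence[where w="\<lambda>_. 1"])
    show "AE \<omega> in M. (\<lambda>n. indicat_real (E (X n)) \<omega>) \<longlonglongrightarrow> indicat_real (E s) \<omega>"
      using AE_right_continuous[OF prob_space_axioms mu_pos critical descent[OF order_refl order_refl]]
    proof eventually_elim
      case (elim \<omega>)
      with s have "\<forall>\<^sub>F s' in at_right s. Z 1 1 s' \<omega> = Z 1 1 s \<omega>" by simp
      then have "\<forall>\<^sub>F n in sequentially. Z 1 1 (X n) \<omega> = Z 1 1 s \<omega>"
        using \<open>filterlim X (at_right s) sequentially\<close> by (rule eventually_compose_filterlim)
      then have "\<forall>\<^sub>F n in sequentially. indicat_real (E (X n)) \<omega> = indicat_real (E s) \<omega>"
        by eventually_elim (simp add: E_def indicator_def)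
      then show "(\<lambda>n. indicat_real (E (X n)) \<omega>) \<longlonglongrightarrow> indicat_real (E s) \<omega>"
        by (rule tendsto_eventually)
    qed
  qed (use E[OF s] E[OF X0] in auto)
  moreover have "ext_prob s = prob (E s)" for s
    by (simp only: ext_prob_def E_def)
  ultimately show ?thesis
    using E[OF s] E[OF X0] by simp
qed

lemma surv_tendsto:
  assumes "0 \<le> s" "\<And>n. s < X n" "X \<longlonglongrightarrow> s"
  shows "(\<lambda>n. surv (X n)) \<longlonglongrightarrow> surv s"
  unfolding surv_def using ext_prob_tendsto[OF assms] ext_prob_bounds by (intro tendsto_intros pgf_tendsto) auto

lemma surv_measurable: "(\<lambda>s. surv s * indicator {0..} s) \<in> borel_measurable borel"
  by (rule borel_measurable_of_right_continuous) (rule surv_tendsto)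

lemma cell_measurable [measurable]: "cell N t \<in> measurable borel (count_space UNIV)"
  unfolding cell_def by measurable

text \<open>Passage to the limit of fine grids. The age \<open>b n u\<close> computed from the rounded arrival time exceeds the true
  age \<open>t - u\<close> and tends to it, so right-continuity applies both to the paths and, in the exponent, to
  \<open>surv\<close>.\<close>

lemma prob_Y_eq_0:
  assumes t: "0 < t"
  shows "prob {\<omega>\<in>space M. Y_process S I Z t \<omega> = 0} = exp (- (LINT u:{0<..t}|lborel. r u * surv (t - u)))"
proof -
  define a where "a n i = max 0 (t - t * real i / real (Suc n))" for n i
  define b where "b n u = a n (cell (Suc n) t u)" for n u
  have b: "t - u < b n u" if "0 < u" "u \<le> t" for n u
    using cell_bounds(1)[OF _ that, of "Suc n"] unfolding b_def a_def less_max_iff_disj by simp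
  have b_lim: "(\<lambda>n. b n u) \<longlonglongrightarrow> t - u" if "0 < u" "u \<le> t" for u
  proof -
    have "(\<lambda>n. max 0 (t - t * real (cell (Suc n) t u) / real (Suc n))) \<longlonglongrightarrow> max 0 (t - u)"
      using cell_start_tendsto[OF that] by (intro tendsto_intros)
    with that show ?thesis by (simp add: b_def a_def max_def)
  qed
  define E where "E n = {\<omega>\<in>space M. \<forall>k\<in>{1..jump_count S t \<omega>}. \<omega> \<in> group_extinct k (b n (S k \<omega>))}" for n
  define E' where "E' = {\<omega>\<in>space M. Y_process S I Z t \<omega> = 0}"
  have E[measurable]: "E n \<in> sets M" "E' \<in> sets M" for n
    unfolding E_def E'_def b_def using prob_all_groups_extinct(2)[of "a n" "cell (Suc n) t" t] Y_event
    by (auto simp: a_def)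
  have prob_E: "prob (E n) = exp (- (LINT u:{0<..t}|lborel. r u * surv (b n u)))" for n
  proof -
    have "prob (E n) = expectation (\<lambda>\<omega>. \<Prod>k=1..jump_count S t \<omega>. (\<lambda>i. 1 - surv (a n i)) (cell (Suc n) t (S k \<omega>)))"
      unfolding E_def b_def by (subst prob_all_groups_extinct(1)) (auto simp: a_def)
    also have "\<dots> = exp (- (LINT u:{0<..t}|lborel. r u * (1 - (\<lambda>i. 1 - surv (a n i)) (cell (Suc n) t u))))"
      using t surv_bounds by (intro expectation_prod_jumps) auto
    finally show ?thesis by (simp add: b_def)
  qed
  have "(\<lambda>n. LINT \<omega>|M. indicat_real (E n) \<omega>) \<longlonglongrightarrow> (LINT \<omega>|M. indicat_real E' \<omega>)"
  proof (rule integral_dominated_convergence[where w="\<lambda>_. 1"])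
    have "AE \<omega> in M. \<forall>k\<in>{1..}. \<forall>j\<in>{1..}. \<forall>s\<ge>0. \<forall>\<^sub>F s' in at_right s. Z k j s' \<omega> = Z k j s \<omega>"
      using AE_right_continuous[OF prob_space_axioms mu_pos critical descent]
      by (intro AE_ball_countable[THEN iffD2] ballI) auto
    with AE_space show "AE \<omega> in M. (\<lambda>n. indicat_real (E n) \<omega>) \<longlonglongrightarrow> indicat_real E' \<omega>"
    proof eventually_elim
      case (elim \<omega>)
      have "\<forall>\<^sub>F n in sequentially. \<forall>k\<in>{1..jump_count S t \<omega>}. \<forall>j\<in>{1..I k \<omega>}.
          Z k j (b n (S k \<omega>)) \<omega> = Z k j (t - S k \<omega>) \<omega>"
      proof (intro eventually_ball_finite ballI)
        fix k j assume kj: "k \<in> {1..jump_count S t \<omega>}" "j \<in> {1..I k \<omega>}"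
        then have S: "0 < S k \<omega>" "S k \<omega> \<le> t"
          using S_pos[OF elim(1)] le_jump_count_iff[OF elim(1)] by auto
        have "filterlim (\<lambda>n. b n (S k \<omega>)) (at_right (t - S k \<omega>)) sequentially"
          unfolding filterlim_at using b_lim[OF S] b[OF S] by (auto intro!: always_eventually simp: less_imp_neq[symmetric])
        moreover have "\<forall>\<^sub>F s' in at_right (t - S k \<omega>). Z k j s' \<omega> = Z k j (t - S k \<omega>) \<omega>"
          using elim(2) kj S by auto
        ultimately show "\<forall>\<^sub>F n in sequentially. Z k j (b n (S k \<omega>)) \<omega> = Z k j (t - S k \<omega>) \<omega>"
          by (rule eventually_compose_filterlim[rotated])
      qed auto
      then have "\<forall>\<^sub>F n in sequentially. indicat_real (E n) \<omega> = indicat_real E' \<omega>"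
      proof eventually_elim
        case (elim n)
        with \<open>\<omega> \<in> space M\<close> have "\<omega> \<in> E n \<longleftrightarrow> \<omega> \<in> E'"
          unfolding E_def E'_def Y_eq_0_iff group_extinct_def by simp
        then show ?case by (simp add: indicator_def)
      qed
      then show ?case by (rule tendsto_eventually)
    qed
  qed (use E in auto)
  then have lim1: "(\<lambda>n. prob (E n)) \<longlonglongrightarrow> prob E'"
    using E by simp
  have "(\<lambda>n. LINT u:{0<..t}|lborel. r u * surv (b n u)) \<longlonglongrightarrow> (LINT u:{0<..t}|lborel. r u * surv (t - u))"
    unfolding set_lebesgue_integral_def
  proof (rule integral_dominated_convergence[where w="\<lambda>u. \<bar>indicator {0<..t} u * r u\<bar>"])
    have "set_integrable lborel {0<..t} r"
      using t by (intro set_integrable_subset[OF r_integrable[of t]]) auto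
    then have int: "integrable lborel (\<lambda>u. indicator {0<..t} u * r u)"
      by (simp add: set_integrable_def)
    then show "integrable lborel (\<lambda>u. \<bar>indicator {0<..t} u * r u\<bar>)" by (rule integrable_abs)
    note [measurable] = borel_measurable_integrable[OF int] surv_measurable
    have "(\<lambda>u. (indicator {0<..t} u * r u) * (surv (t - u) * indicator {0..} (t - u))) \<in> borel_measurable lborel"
      by measurable
    also have "(\<lambda>u. (indicator {0<..t} u * r u) * (surv (t - u) * indicator {0..} (t - u))) =
        (\<lambda>u. indicat_real {0<..t} u *\<^sub>R (r u * surv (t - u)))"
      by (auto simp: indicator_def)
    finally show "(\<lambda>u. indicat_real {0<..t} u *\<^sub>R (r u * surv (t - u))) \<in> borel_measurable lborel" .
    have "(\<lambda>u. (indicator {0<..t} u * r u) * surv (a n (cell (Suc n) t u))) \<in> borel_measurable lborel" for n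
      by measurable
    then show "(\<lambda>u. indicat_real {0<..t} u *\<^sub>R (r u * surv (b n u))) \<in> borel_measurable lborel" for n
      by (simp add: b_def mult_ac)
    show "AE u in lborel. (\<lambda>n. indicat_real {0<..t} u *\<^sub>R (r u * surv (b n u))) \<longlonglongrightarrow>
        indicat_real {0<..t} u *\<^sub>R (r u * surv (t - u))"
    proof (intro AE_I2)
      fix u :: real
      show "(\<lambda>n. indicat_real {0<..t} u *\<^sub>R (r u * surv (b n u))) \<longlonglongrightarrow>
        indicat_real {0<..t} u *\<^sub>R (r u * surv (t - u))"
      proof (cases "u \<in> {0<..t}")
        case True
        then show ?thesis
          using b b_lim by (intro tendsto_intros surv_tendsto) auto
      qed simp
    qed
    show "AE u in lborel. norm (indicat_real {0<..t} u *\<^sub>R (r u * surv (b n u))) \<le> \<bar>indicator {0<..t} u * r u\<bar>" for n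
      using surv_bounds[of "b n _"] by (intro AE_I2) (auto simp: abs_mult indicator_def intro!: mult_left_le)
  qed
  then have "(\<lambda>n. prob (E n)) \<longlonglongrightarrow> exp (- (LINT u:{0<..t}|lborel. r u * surv (t - u)))"
    unfolding prob_E by (intro tendsto_intros)
  from LIMSEQ_unique[OF lim1 this] show ?thesis unfolding E'_def .
qed

lemma prob_Y_pos:
  assumes "0 < t"
  shows "prob {\<omega>\<in>space M. 0 < Y_process S I Z t \<omega>} =
    1 - exp (- (LINT u:{0<..t}|lborel. r u * surv (t - u)))"
proof -
  have "{\<omega>\<in>space M. 0 < Y_process S I Z t \<omega>} = space M - {\<omega>\<in>space M. Y_process S I Z t \<omega> = 0}"
    by auto
  then show ?thesis
    using prob_compl[OF Y_event, of t] prob_Y_eq_0[OF assms] by simp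
qed

end

section \<open>The asymptotic behaviour\<close>

theorem theorem4p3:
  fixes M :: "'a measure" and \<mu> \<alpha> \<gamma> \<theta> :: real
    and p h :: "nat pmf"
    and r L l L_R L_Q q :: "real \<Rightarrow> real"
    and S :: "nat \<Rightarrow> 'a \<Rightarrow> real" and I :: "nat \<Rightarrow> 'a \<Rightarrow> nat"
    and Z :: "nat \<Rightarrow> nat \<Rightarrow> real \<Rightarrow> 'a \<Rightarrow> nat" and Y :: "real \<Rightarrow> 'a \<Rightarrow> nat"
  defines "Y \<equiv> Y_process S I Z"
    and "q \<equiv> (\<lambda>t. q_fun M h (Z 1 1) t 0)"
  assumes model: "branching_immigration_model M \<mu> p h r S I Z"
    and critical: "mean_one p"
    and gamma: "0 < \<gamma>" "\<gamma> \<le> 1"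
    and alpha: "0 < \<alpha>" "\<alpha> \<le> 1"
    and sv_L: "slowly_varying L"
    and sv_l: "slowly_varying l"
    and sv_L_R: "slowly_varying L_R"
    and offspring: "\<And>s. s \<in> {0..<1} \<Longrightarrow>
      pgf p s = s + (1 - s) powr (\<gamma> + 1) * L (1 / (1 - s))"
    and immigrants: "\<And>s. s \<in> {0..<1} \<Longrightarrow>
      pgf h s = 1 - (1 - s) powr \<alpha> * l (1 / (1 - s))"
    and intensity: "\<And>t. t > 0 \<Longrightarrow> r t = t powr (- \<theta>) * L_R t"
    and theta: "0 < \<theta>" "\<theta> < 1"
    and ratio: "0 < \<alpha> / \<gamma>" "\<alpha> / \<gamma> < 1"
    and sv_L_Q: "slowly_varying L_Q"
    and q_asymp: "q \<sim>[at_top] (\<lambda>t. t powr (- \<alpha> / \<gamma>) * L_Q t)"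
  shows
    "((\<theta> + \<alpha> / \<gamma> > 1 \<or>
         (\<theta> + \<alpha> / \<gamma> = 1 \<and> ((\<lambda>t. L_R t * L_Q t) \<longlongrightarrow> 0) at_top)) \<longrightarrow>
        (\<lambda>t. measure M {\<omega>\<in>space M. Y t \<omega> > 0})
          \<sim>[at_top] (\<lambda>t. t * r t * q t * Beta (1 - \<alpha> / \<gamma>) (1 - \<theta>))) \<and>
     (\<forall>K>0. \<theta> + \<alpha> / \<gamma> = 1 \<and> ((\<lambda>t. L_R t * L_Q t) \<longlongrightarrow> K) at_top \<longrightarrow>
        ((\<lambda>t. measure M {\<omega>\<in>space M. Y t \<omega> > 0})
          \<longlongrightarrow> 1 - exp (- K * pi / sin (pi * \<theta>))) at_top) \<and>
     ((\<theta> + \<alpha> / \<gamma> < 1 \<or>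
         (\<theta> + \<alpha> / \<gamma> = 1 \<and> filterlim (\<lambda>t. L_R t * L_Q t) at_top at_top)) \<longrightarrow>
        ((\<lambda>t. measure M {\<omega>\<in>space M. Y t \<omega> > 0}) \<longlongrightarrow> 1) at_top)"
proof -
  interpret branching_immigration M \<mu> p h r S I Z
    by unfold_locales (fact model critical)+
  define b where "b = \<alpha> / \<gamma>"
  have b: "0 < b" "b < 1" using ratio by (simp_all add: b_def)
  define B where "B = Beta (1 - b) (1 - \<theta>)"
  have B: "0 < B" using b theta by (auto simp: B_def Beta_def intro!: divide_pos_pos mult_pos_pos)
  have q_surv: "q t = surv t" if "0 \<le> t" for t
    using surv_eq_q_fun[OF that] by (simp add: q_def)
  define \<Lambda> where "\<Lambda> t = (LINT u:{0<..t}|lborel. r u * surv (t - u))" for t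
  have prob_Y: "measure M {\<omega>\<in>space M. Y t \<omega> > 0} = 1 - exp (- \<Lambda> t)" if "0 < t" for t
    using prob_Y_pos[OF that] by (simp add: Y_def \<Lambda>_def)
  define D where "D t = t * r t * q t" for t
  have q_equiv: "q \<sim>[at_top] (\<lambda>t. t powr (- b) * L_Q t)"
    using q_asymp by (simp add: b_def)
  have \<Lambda>_D: "((\<lambda>t. \<Lambda> t / D t) \<longlongrightarrow> B) at_top"
  proof -
    \<comment> \<open>The value of the intensity at 0 is arbitrary, hence the open half-line.\<close>
    define f where "f u = indicator {0<..} u * r u" for u
    define g where "g u = indicator {0<..} u * surv u" for u
    have f_int: "integrable lborel (\<lambda>u. indicator {..<A} u * f u)" for A
    proof -
      have "set_integrable lborel {0<..<max A 0} r"
        by (rule set_integrable_subset[OF r_integrable[of "max A 0"]]) auto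
      moreover have "(\<lambda>u. indicat_real {0<..<max A 0} u *\<^sub>R r u) = (\<lambda>u. indicator {..<A} u * f u)"
        by (auto simp: f_def fun_eq_iff split: split_indicator)
      ultimately show ?thesis by (simp add: set_integrable_def)
    qed
    have f_meas: "f \<in> borel_measurable borel"
    proof (rule borel_measurable_LIMSEQ_real)
      show "(\<lambda>u. indicator {..<real n} u * f u) \<in> borel_measurable borel" for n
        using borel_measurable_integrable[OF f_int[of "real n"]] by simp
      fix u
      have "\<forall>\<^sub>F n in sequentially. u < real n"
        using filterlim_real_sequentially by (simp add: filterlim_at_top_dense)
      then have "\<forall>\<^sub>F n in sequentially. indicator {..<real n} u * f u = f u"
        by eventually_elim simp
      then show "(\<lambda>n. indicator {..<real n} u * f u) \<longlonglongrightarrow> f u" by (rule tendsto_eventually)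
    qed
    have "(\<lambda>u. indicator {0<..} u * (surv u * indicator {0..} u)) \<in> borel_measurable borel"
      using surv_measurable by measurable
    also have "(\<lambda>u. indicator {0<..} u * (surv u * indicator {0..} u)) = g"
      by (auto simp: g_def indicator_def)
    finally have g_meas: "g \<in> borel_measurable borel" .
    have g_int: "integrable lborel (\<lambda>u. indicator {..<A} u * g u)" for A
    proof (rule Bochner_Integration.integrable_bound)
      show "integrable lborel (indicat_real {0..max A 0})" by simp
      show "(\<lambda>u. indicator {..<A} u * g u) \<in> borel_measurable lborel" using g_meas by simp
      show "AE u in lborel. norm (indicator {..<A} u * g u) \<le> norm (indicat_real {0..max A 0} u)"
        using surv_bounds by (intro AE_I2) (auto simp: g_def indicator_def)
    qed
    have "f \<sim>[at_top] (\<lambda>t. t powr (- \<theta>) * L_R t)"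
      by (rule asymp_equiv_refl_ev)
         (use eventually_gt_at_top[of 0] in eventually_elim, simp add: f_def intensity)
    then have rv_f: "regularly_varying f (- \<theta>)"
      using sv_L_R unfolding regularly_varying_def by blast
    have "g \<sim>[at_top] q"
      by (rule asymp_equiv_refl_ev)
         (use eventually_gt_at_top[of 0] in eventually_elim, simp add: g_def q_surv)
    from asymp_equiv_trans[OF this q_equiv] have rv_g: "regularly_varying g (- b)"
      using sv_L_Q unfolding regularly_varying_def by blast
    have lim: "((\<lambda>t. (LINT u|lborel. f u * g (t - u)) / (t * f t * g t)) \<longlongrightarrow> Beta (1 - b) (1 - \<theta>)) at_top"
      by (rule convolution_asymp_equiv[OF _ _ f_int _ _ g_int f_meas g_meas rv_f rv_g])
         (use b theta r_nonneg surv_bounds in \<open>auto simp: f_def g_def indicator_def\<close>)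
    have eq: "(LINT u|lborel. f u * g (t - u)) = \<Lambda> t" for t
      unfolding \<Lambda>_def set_lebesgue_integral_def
    proof (rule integral_cong_AE)
      have "(\<lambda>u. f u * (surv (t - u) * indicator {0..} (t - u))) \<in> borel_measurable lborel"
        using f_meas surv_measurable by measurable
      also have "(\<lambda>u. f u * (surv (t - u) * indicator {0..} (t - u))) = (\<lambda>u. indicat_real {0<..t} u *\<^sub>R (r u * surv (t - u)))"
        by (auto simp: f_def indicator_def)
      finally show "(\<lambda>u. indicat_real {0<..t} u *\<^sub>R (r u * surv (t - u))) \<in> borel_measurable lborel" .
      show "AE u in lborel. f u * g (t - u) = indicat_real {0<..t} u *\<^sub>R (r u * surv (t - u))"
        using AE_lborel_singleton[of t] by eventually_elim (auto simp: f_def g_def indicator_def)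
    qed (use f_meas g_meas in measurable)
    have "\<forall>\<^sub>F t in at_top. (LINT u|lborel. f u * g (t - u)) / (t * f t * g t) = \<Lambda> t / D t"
      using eventually_gt_at_top[of 0] by eventually_elim (simp only: eq, simp add: D_def f_def g_def q_surv)
    with lim show ?thesis unfolding B_def by (rule Lim_transform_eventually)
  qed
  define s where "s = 1 - \<theta> - b"
  define L' where "L' t = L_R t * L_Q t" for t
  have sv_L': "slowly_varying L'"
    unfolding L'_def using sv_L_R sv_L_Q by (rule slowly_varying_mult)
  obtain A where A: "1 \<le> A" "\<And>t. A \<le> t \<Longrightarrow> 0 < L' t"
    using slowly_varyingE[OF sv_L'] by blast
  obtain A_Q where A_Q: "1 \<le> A_Q" "\<And>t. A_Q \<le> t \<Longrightarrow> 0 < L_Q t"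
    using slowly_varyingE[OF sv_L_Q] by blast
  \<comment> \<open>The size of \<open>\<Lambda>\<close> is thus governed by the sign of \<open>s\<close> and, if \<open>s = 0\<close>, by \<open>L'\<close>.\<close>
  have D_ratio: "((\<lambda>t. D t / (t powr s * L' t)) \<longlongrightarrow> 1) at_top"
  proof -
    have "((\<lambda>t. q t / (t powr (- b) * L_Q t)) \<longlongrightarrow> 1) at_top"
    proof (rule asymp_equivD_strong[OF q_equiv])
      show "\<forall>\<^sub>F t in at_top. q t \<noteq> 0 \<or> t powr (- b) * L_Q t \<noteq> 0"
        using eventually_ge_at_top[of A_Q] by eventually_elim (use A_Q in force)
    qed
    moreover have "\<forall>\<^sub>F t in at_top. q t / (t powr (- b) * L_Q t) = D t / (t powr s * L' t)"
      using eventually_ge_at_top[of A]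
    proof eventually_elim
      case (elim t)
      then have t: "0 < t" using A(1) by simp
      have "t powr s = t * (t powr (- \<theta>) * t powr (- b))"
        using t by (simp add: s_def powr_diff powr_minus powr_add field_simps)
      moreover have "L_R t \<noteq> 0" using A(2)[OF elim] by (auto simp: L'_def)
      ultimately show ?case using t by (simp add: D_def intensity L'_def field_simps)
    qed
    ultimately show ?thesis by (rule Lim_transform_eventually)
  qed
  have D_eq: "\<forall>\<^sub>F t in at_top. (D t / (t powr s * L' t)) * (t powr s * L' t) = D t"
    using eventually_ge_at_top[of A] by eventually_elim (use A in force)
  have \<Lambda>_eq: "\<forall>\<^sub>F t in at_top. (\<Lambda> t / D t) * D t = \<Lambda> t"
  proof -
    have "\<forall>\<^sub>F t in at_top. 0 < \<Lambda> t / D t" using \<Lambda>_D B by (rule order_tendstoD)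
    then show ?thesis by eventually_elim auto
  qed
  have exp_lim: "((\<lambda>x. (1 - exp (- x)) / x) \<longlongrightarrow> 1) (at (0::real))"
  proof -
    have "((\<lambda>x. 1 - exp (- x)) has_real_derivative 1) (at 0)"
      by (auto intro!: derivative_eq_intros)
    then show ?thesis by (simp add: DERIV_def)
  qed
  have prob_lim: "((\<lambda>t. measure M {\<omega>\<in>space M. Y t \<omega> > 0}) \<longlongrightarrow> x) at_top"
    if "((\<lambda>t. 1 - exp (- \<Lambda> t)) \<longlongrightarrow> x) at_top" for x
    using that
    by (rule Lim_transform_eventually)
       (use eventually_gt_at_top[of 0] in eventually_elim, simp add: prob_Y)
  show ?thesis
  proof (intro conjI impI allI)
    assume case_i: "\<theta> + \<alpha> / \<gamma> > 1 \<or> (\<theta> + \<alpha> / \<gamma> = 1 \<and> ((\<lambda>t. L_R t * L_Q t) \<longlongrightarrow> 0) at_top)"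
    have "((\<lambda>t. t powr s * L' t) \<longlongrightarrow> 0) at_top"
    proof (cases "\<theta> + b > 1")
      case True
      then show ?thesis
        using slowly_varying_powr_0[OF sv_L', of "- s"] by (simp add: s_def)
    next
      case False
      with case_i have "s = 0" "(L' \<longlongrightarrow> 0) at_top" by (auto simp: s_def b_def L'_def[abs_def])
      moreover have "\<forall>\<^sub>F t in at_top. L' t = t powr 0 * L' t"
        using eventually_gt_at_top[of 0] by eventually_elim simp
      ultimately show ?thesis by (simp add: Lim_transform_eventually)
    qed
    from tendsto_mult[OF D_ratio this] have D_0: "(D \<longlongrightarrow> 0) at_top"
      using Lim_transform_eventually[OF _ D_eq] by simp
    from tendsto_mult[OF \<Lambda>_D this] have \<Lambda>_0: "(\<Lambda> \<longlongrightarrow> 0) at_top"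
      using Lim_transform_eventually[OF _ \<Lambda>_eq] by simp
    have pos: "\<forall>\<^sub>F t in at_top. 0 < \<Lambda> t / D t" using \<Lambda>_D B by (rule order_tendstoD)
    then have "filterlim \<Lambda> (at 0) at_top"
      using \<Lambda>_0 unfolding filterlim_at by (auto elim!: eventually_mono)
    from filterlim_compose[OF exp_lim this]
    have "((\<lambda>t. ((1 - exp (- \<Lambda> t)) / \<Lambda> t) * (\<Lambda> t / D t) / B) \<longlongrightarrow> 1 * B / B) at_top"
      using \<Lambda>_D B by (intro tendsto_intros) auto
    moreover have "\<forall>\<^sub>F t in at_top. ((1 - exp (- \<Lambda> t)) / \<Lambda> t) * (\<Lambda> t / D t) / B =
        measure M {\<omega>\<in>space M. Y t \<omega> > 0} / (t * r t * q t * Beta (1 - \<alpha> / \<gamma>) (1 - \<theta>))"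
      using pos eventually_gt_at_top[of 0]
    proof eventually_elim
      case (elim t)
      then have "\<Lambda> t \<noteq> 0" by auto
      then have "((1 - exp (- \<Lambda> t)) / \<Lambda> t) * (\<Lambda> t / D t) / B = (1 - exp (- \<Lambda> t)) / (D t * B)"
        by simp
      then show ?case by (simp only: prob_Y[OF elim(2)] D_def B_def b_def)
    qed
    ultimately have "((\<lambda>t. measure M {\<omega>\<in>space M. Y t \<omega> > 0} /
        (t * r t * q t * Beta (1 - \<alpha> / \<gamma>) (1 - \<theta>))) \<longlongrightarrow> 1) at_top"
      using B by (simp add: Lim_transform_eventually)
    then show "(\<lambda>t. measure M {\<omega>\<in>space M. Y t \<omega> > 0})
        \<sim>[at_top] (\<lambda>t. t * r t * q t * Beta (1 - \<alpha> / \<gamma>) (1 - \<theta>))"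
      by (rule asymp_equivI')
  next
    fix K :: real
    assume "0 < K" and case_ii: "\<theta> + \<alpha> / \<gamma> = 1 \<and> ((\<lambda>t. L_R t * L_Q t) \<longlongrightarrow> K) at_top"
    then have s: "s = 0" "1 - b = \<theta>" and L'_K: "(L' \<longlongrightarrow> K) at_top"
      by (auto simp: s_def b_def L'_def[abs_def])
    have "\<forall>\<^sub>F t in at_top. L' t = t powr s * L' t"
      using eventually_gt_at_top[of 0] by eventually_elim (simp add: s)
    from tendsto_mult[OF D_ratio Lim_transform_eventually[OF L'_K this]] have "(D \<longlongrightarrow> K) at_top"
      using Lim_transform_eventually[OF _ D_eq] by simp
    from tendsto_mult[OF \<Lambda>_D this] have "(\<Lambda> \<longlongrightarrow> B * K) at_top"
      using Lim_transform_eventually[OF _ \<Lambda>_eq] by simp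
    then have "((\<lambda>t. 1 - exp (- \<Lambda> t)) \<longlongrightarrow> 1 - exp (- (B * K))) at_top"
      by (intro tendsto_intros)
    moreover have "- (B * K) = - K * pi / sin (pi * \<theta>)"
      using theta s by (simp add: B_def Beta_reflection)
    ultimately show "((\<lambda>t. measure M {\<omega>\<in>space M. Y t \<omega> > 0}) \<longlongrightarrow> 1 - exp (- K * pi / sin (pi * \<theta>))) at_top"
      by (intro prob_lim) simp
  next
    assume case_iii: "\<theta> + \<alpha> / \<gamma> < 1 \<or> (\<theta> + \<alpha> / \<gamma> = 1 \<and> filterlim (\<lambda>t. L_R t * L_Q t) at_top at_top)"
    have "filterlim (\<lambda>t. t powr s * L' t) at_top at_top"
    proof (cases "\<theta> + b < 1")
      case True
      then show ?thesis by (intro slowly_varying_powr_at_top[OF sv_L']) (simp add: s_def)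
    next
      case False
      with case_iii have s: "s = 0" and lim: "filterlim L' at_top at_top"
        by (auto simp: s_def b_def L'_def[abs_def])
      have "\<forall>\<^sub>F t in at_top. L' t = t powr s * L' t"
        using eventually_gt_at_top[of 0] by eventually_elim (simp add: s)
      from filterlim_cong[OF refl refl this, THEN iffD1, OF lim] show ?thesis .
    qed
    from filterlim_tendsto_pos_mult_at_top[OF D_ratio zero_less_one this]
    have "filterlim D at_top at_top"
      by (rule filterlim_cong[OF refl refl D_eq, THEN iffD1])
    from filterlim_tendsto_pos_mult_at_top[OF \<Lambda>_D B this]
    have "filterlim \<Lambda> at_top at_top"
      by (rule filterlim_cong[OF refl refl \<Lambda>_eq, THEN iffD1])
    then have "((\<lambda>t. exp (- \<Lambda> t)) \<longlongrightarrow> 0) at_top"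
      by (intro filterlim_compose[OF exp_at_bot] filterlim_compose[OF filterlim_uminus_at_bot_at_top])
    then have "((\<lambda>t. 1 - exp (- \<Lambda> t)) \<longlongrightarrow> 1 - 0) at_top"
      by (intro tendsto_intros)
    then show "((\<lambda>t. measure M {\<omega>\<in>space M. Y t \<omega> > 0}) \<longlongrightarrow> 1) at_top"
      by (intro prob_lim) simp
  qed
qed

end
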